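(* Let $R$ be a commutative ring and let $n \geq 0$. There exist an ordered basis $\mathcal{B}_1$ of $\Lambda_1(R^{n+1})$ and an ordered basis $\mathcal{B}_0$ of $\Lambda_0(R^{n+1})$ such that for all $x=(p,a,f,b) \in R^{n+1}\oplus (R^{n+1})^\vee = R^{n+1}\oplus R^{n+1}$ (with $p \in R^n$, $a \in R$, $f \in (R^n)^\vee = R^n$, $b \in R^\vee = R$), the matrix representing $\Phi_{1,0}(x):\Lambda_1(R^{n+1})\to\Lambda_0(R^{n+1})$ with respect to $\mathcal{B}_1$ (source) and $\mathcal{B}_0$ (target) is $S_{n+1}(b,f,a,p)$, and the matrix representing $\Phi_{0,1}(x):\Lambda_0(R^{n+1})\to\Lambda_1(R^{n+1})$ with respect to $\mathcal{B}_0$ (source) and $\mathcal{B}_1$ (target) is $\overline{S_{n+1}(b,f,a,p)}$.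
   Context: $R$ is a commutative ring; $R^m$ is identified with $(R^m)^\vee$ via the standard basis and its dual basis. Suslin matrices: for $m\ge 1$ and $u=(u_1,\dots,u_m), v=(v_1,\dots,v_m)\in R^m$, the $2^{m-1}\times 2^{m-1}$ matrices $S_m(u,v)$ and $\overline{S_m(u,v)}$ are defined by $S_1(u,v)=(u_1)$, $\overline{S_1(u,v)}=(v_1)$, and for $m\geq 2$, with $u'=(u_2,\dots,u_m)$, $v'=(v_2,\dots,v_m)$ and $I$ the identity matrix of size $2^{m-2}$, $$S_m(u,v)=\begin{pmatrix} u_1 I & S_{m-1}(u',v')\\ -S_{m-1}(v',u')^t & v_1 I\end{pmatrix},\qquad \overline{S_m(u,v)}=\begin{pmatrix} v_1 I & -S_{m-1}(u',v')\\ S_{m-1}(v',u')^t & u_1 I\end{pmatrix}.$$ For $p,f\in R^n$ and $a,b\in R$, $S_{n+1}(b,f,a,p)$ means $S_{n+1}(u,v)$ with $u=(b,f)=(b,f_1,\dots,f_n)$ and $v=(a,p)=(a,p_1,\dots,p_n)$; similarly for $\overline{S_{n+1}(b,f,a,p)}$. Exterior algebra: for a finitely generated projective $R$-module $Q$, $\Lambda(Q)=\Lambda_0(Q)\oplus\Lambda_1(Q)$ with $\Lambda_0(Q)=\bigoplus_{i\ge0}\Lambda^{2i}(Q)$ and $\Lambda_1(Q)=\bigoplus_{i\ge0}\Lambda^{2i+1}(Q)$. The map $\Phi$: let $P=R^n$ and $x=(p,a,f,b)\in P\oplus R\oplus P^\vee\oplus R^\vee$. Put $x'=(p,a)\in P\oplus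 R$ and $x''=(f,b)\in (P\oplus R)^\vee$. Let $l_{x'}:\Lambda(P\oplus R)\to\Lambda(P\oplus R)$ be left multiplication $\omega\mapsto x'\wedge\omega$, and let $d_{x''}$ be given by $d_{x''}(y_1\wedge\dots\wedge y_r)=\sum_{i=1}^r(-1)^{i+1}x''(y_i)\,y_1\wedge\dots\wedge\widehat{y_i}\wedge\dots\wedge y_r$. Set $\Phi(x)=l_{x'}+d_{x''}$. It interchanges $\Lambda_0$ and $\Lambda_1$; $\Phi_{1,0}(x):\Lambda_1(P\oplus R)\to\Lambda_0(P\oplus R)$ and $\Phi_{0,1}(x):\Lambda_0(P\oplus R)\to\Lambda_1(P\oplus R)$ denote its restrictions. Here $P\oplus R=R^{n+1}$. (This $\Phi$ induces the classical isomorphism from the Clifford algebra of the hyperbolic form $q(p,a,f,b)=f(p)+ab$ to $\mathrm{End}(\Lambda(P\oplus R))$.) *)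

theory Defs
  imports
    "HOL-Algebra.QuotRing"
    "HOL-Library.Poly_Mapping"
    "Jordan_Normal_Form.Matrix"
begin

text \<open>
  The base ring is a type of sort \<open>{comm_ring, comm_monoid_mult}\<close>: a commutative ring with unit.
  The class \<open>comm_ring_1\<close> would in addition exclude the zero ring. Elements of \<open>R\<^sup>m\<close> are the
  vectors in \<open>carrier_vec m\<close>; coordinates are numbered from \<open>0\<close>.
\<close>

section \<open>Suslin matrices\<close>

text \<open>
  In \<open>suslin m u v\<close> the vectors have length \<open>m \<ge> 1\<close>; the value at \<open>m = 0\<close> is unspecified.
  \<open>vec_last u (Suc k)\<close> is the vector \<open>u\<close>, of length \<open>k + 2\<close>, without its first entry.
\<close>

fun suslin :: "nat \<Rightarrow> 'a::{comm_ring,comm_monoid_mult} vec \<Rightarrow> 'a vec \<Rightarrow> 'a mat" where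
  "suslin (Suc 0) u v = mat 1 1 (\<lambda>_. u $ 0)"
| "suslin (Suc (Suc k)) u v =
     (let u' = vec_last u (Suc k); v' = vec_last v (Suc k); I = 1\<^sub>m (2 ^ k) in
      four_block_mat
        (u $ 0 \<cdot>\<^sub>m I)                          (suslin (Suc k) u' v')
        (- transpose_mat (suslin (Suc k) v' u'))   (v $ 0 \<cdot>\<^sub>m I))"

fun suslin_bar :: "nat \<Rightarrow> 'a::{comm_ring,comm_monoid_mult} vec \<Rightarrow> 'a vec \<Rightarrow> 'a mat" where
  "suslin_bar (Suc 0) u v = mat 1 1 (\<lambda>_. v $ 0)"
| "suslin_bar (Suc (Suc k)) u v =
     (let u' = vec_last u (Suc k); v' = vec_last v (Suc k); I = 1\<^sub>m (2 ^ k) in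
      four_block_mat
        (v $ 0 \<cdot>\<^sub>m I)                          (- suslin (Suc k) u' v')
        (transpose_mat (suslin (Suc k) v' u'))     (u $ 0 \<cdot>\<^sub>m I))"

section \<open>The exterior algebra of \<open>R\<^sup>m\<close>\<close>

text \<open>Lists form the free monoid, so that \<open>'v list \<Rightarrow>\<^sub>0 'a\<close> with its convolution product is the
  free unital \<open>'a\<close>-algebra on the set \<open>'v\<close>.\<close>

instantiation list :: (type) monoid_add
begin

definition zero_list :: "'a list" where "zero_list = []"

definition plus_list :: "'a list \<Rightarrow> 'a list \<Rightarrow> 'a list" where "plus_list xs ys = xs @ ys"

instance
  by standard (simp_all add: zero_list_def plus_list_def)

end

type_synonym 'a tens = "'a vec list \<Rightarrow>\<^sub>0 'a"

type_synonym 'a ext = "'a tens set"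

text \<open>The free algebra on the underlying set of \<open>R\<^sup>m\<close>. A word \<open>[y\<^sub>1, \<dots>, y\<^sub>r]\<close> becomes
  \<open>y\<^sub>1 \<otimes> \<dots> \<otimes> y\<^sub>r\<close> modulo the first two families of \<open>ext_relations\<close>, and
  \<open>y\<^sub>1 \<and> \<dots> \<and> y\<^sub>r\<close> modulo all three.\<close>

definition free_alg :: "nat \<Rightarrow> 'a::{comm_ring,comm_monoid_mult} tens ring" where
  "free_alg m =
     \<lparr>carrier = {t. \<forall>w\<in>Poly_Mapping.keys t. set w \<subseteq> carrier_vec m},
      monoid.mult = (*), one = Poly_Mapping.single [] 1, zero = 0, add = (+)\<rparr>"

definition ext_relations :: "nat \<Rightarrow> 'a::{comm_ring,comm_monoid_mult} tens set" where
  "ext_relations m =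
     {Poly_Mapping.single [x + y] 1 - Poly_Mapping.single [x] 1 - Poly_Mapping.single [y] 1 | x y.
        x \<in> carrier_vec m \<and> y \<in> carrier_vec m}
   \<union> {Poly_Mapping.single [r \<cdot>\<^sub>v x] 1 - Poly_Mapping.single [x] r | r x. x \<in> carrier_vec m}
   \<union> {Poly_Mapping.single [x, x] 1 | x. x \<in> carrier_vec m}"

definition ext_ideal :: "nat \<Rightarrow> 'a::{comm_ring,comm_monoid_mult} tens set" where
  "ext_ideal m = genideal (free_alg m) (ext_relations m)"

definition ext_alg :: "nat \<Rightarrow> 'a::{comm_ring,comm_monoid_mult} ext ring" where
  "ext_alg m = free_alg m Quot ext_ideal m"

definition ext_class :: "nat \<Rightarrow> 'a::{comm_ring,comm_monoid_mult} tens \<Rightarrow> 'a ext" where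
  "ext_class m t = ext_ideal m +>\<^bsub>free_alg m\<^esub> t"

definition ext_scale :: "nat \<Rightarrow> 'a::{comm_ring,comm_monoid_mult} \<Rightarrow> 'a ext \<Rightarrow> 'a ext" where
  "ext_scale m r \<omega> = ext_class m (Poly_Mapping.single [] r) \<otimes>\<^bsub>ext_alg m\<^esub> \<omega>"

text \<open>\<open>\<Lambda>\<^sup>k(R\<^sup>m)\<close>, as a submodule of \<open>\<Lambda>(R\<^sup>m)\<close>: all linear combinations of \<open>k\<close>-fold products of vectors.\<close>

definition ext_power :: "nat \<Rightarrow> nat \<Rightarrow> 'a::{comm_ring,comm_monoid_mult} ext set" where
  "ext_power m k =
     ext_class m ` {t \<in> carrier (free_alg m). \<forall>w\<in>Poly_Mapping.keys t. length w = k}"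

definition ext_even :: "nat \<Rightarrow> 'a::{comm_ring,comm_monoid_mult} ext set" where
  "ext_even m = {\<Oplus>\<^bsub>ext_alg m\<^esub>i\<in>{..N}. c i | N c. \<forall>i. c i \<in> ext_power m (2 * i)}"

definition ext_odd :: "nat \<Rightarrow> 'a::{comm_ring,comm_monoid_mult} ext set" where
  "ext_odd m = {\<Oplus>\<^bsub>ext_alg m\<^esub>i\<in>{..N}. c i | N c. \<forall>i. c i \<in> ext_power m (2 * i + 1)}"

section \<open>The map \<open>\<Phi>\<close>\<close>

definition left_wedge :: "nat \<Rightarrow> 'a::{comm_ring,comm_monoid_mult} vec \<Rightarrow> 'a ext \<Rightarrow> 'a ext" where
  "left_wedge m y \<omega> = ext_class m (Poly_Mapping.single [y] 1) \<otimes>\<^bsub>ext_alg m\<^esub> \<omega>"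

text \<open>The linear extension to the free algebra of
  \<open>[y\<^sub>1, \<dots>, y\<^sub>r] \<mapsto> \<Sum>i. (-1)\<^sup>i\<^sup>+\<^sup>1 \<phi>(y\<^sub>i) [y\<^sub>1, \<dots>, y\<^sub>i\<^sub>-\<^sub>1, y\<^sub>i\<^sub>+\<^sub>1, \<dots>, y\<^sub>r]\<close>; list positions start at \<open>0\<close>,
  hence the exponent \<open>i\<close> in the definition.\<close>

definition free_contract :: "('a vec \<Rightarrow> 'a) \<Rightarrow> 'a::{comm_ring,comm_monoid_mult} tens \<Rightarrow> 'a tens" where
  "free_contract \<phi> t =
     (\<Sum>w\<in>Poly_Mapping.keys t. \<Sum>i<length w.
        Poly_Mapping.single (take i w @ drop (Suc i) w)
          (Poly_Mapping.lookup t w * ((- 1) ^ i * \<phi> (w ! i))))"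

text \<open>The induced map on the quotient. For linear \<open>\<phi>\<close>, \<open>free_contract \<phi>\<close> preserves the ideal, so
  that all the cosets in the union coincide (the same encoding as in \<^const>\<open>rcoset_mult\<close>).\<close>

definition contract ::
  "nat \<Rightarrow> ('a vec \<Rightarrow> 'a) \<Rightarrow> 'a::{comm_ring,comm_monoid_mult} ext \<Rightarrow> 'a ext" where
  "contract m \<phi> \<omega> = (\<Union>t\<in>\<omega>. ext_class m (free_contract \<phi> t))"

text \<open>\<open>R\<^sup>n \<oplus> R = R\<^sup>n\<^sup>+\<^sup>1\<close> by appending a last coordinate; a vector is identified with a linear form
  through the standard dual basis, that is, through \<^const>\<open>scalar_prod\<close>.\<close>

definition Phi ::
  "nat \<Rightarrow> 'a vec \<times> 'a \<times> 'a vec \<times> 'a \<Rightarrow> 'a::{comm_ring,comm_monoid_mult} ext \<Rightarrow> 'a ext" where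
  "Phi n = (\<lambda>(p, a, f, b) \<omega>.
     left_wedge (Suc n) (p @\<^sub>v vec_of_list [a]) \<omega>
       \<oplus>\<^bsub>ext_alg (Suc n)\<^esub> contract (Suc n) (scalar_prod (f @\<^sub>v vec_of_list [b])) \<omega>)"

definition Phi_10 ::
  "nat \<Rightarrow> 'a vec \<times> 'a \<times> 'a vec \<times> 'a \<Rightarrow> 'a::{comm_ring,comm_monoid_mult} ext \<Rightarrow> 'a ext" where
  "Phi_10 n x = restrict (Phi n x) (ext_odd (Suc n))"

definition Phi_01 ::
  "nat \<Rightarrow> 'a vec \<times> 'a \<times> 'a vec \<times> 'a \<Rightarrow> 'a::{comm_ring,comm_monoid_mult} ext \<Rightarrow> 'a ext" where
  "Phi_01 n x = restrict (Phi n x) (ext_even (Suc n))"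

section \<open>Ordered bases and representing matrices\<close>

definition ext_lincomb ::
  "nat \<Rightarrow> 'a::{comm_ring,comm_monoid_mult} vec \<Rightarrow> 'a ext list \<Rightarrow> 'a ext" where
  "ext_lincomb m c B = (\<Oplus>\<^bsub>ext_alg m\<^esub>i\<in>{..<length B}. ext_scale m (c $ i) (B ! i))"

definition ordered_basis ::
  "nat \<Rightarrow> 'a::{comm_ring,comm_monoid_mult} ext set \<Rightarrow> 'a ext list \<Rightarrow> bool" where
  "ordered_basis m M B \<longleftrightarrow> set B \<subseteq> M \<and>
     (\<forall>\<omega>\<in>M. \<exists>!c. c \<in> carrier_vec (length B) \<and> \<omega> = ext_lincomb m c B)"

text \<open>\<open>A\<close> maps the coordinates of each \<open>\<omega>\<close> in the basis \<open>B\<close> to those of \<open>g \<omega>\<close> in the basis \<open>B'\<close>.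
  Taking unit vectors for \<open>c\<close>, the columns of \<open>A\<close> are the coordinates of the images of \<open>B\<close>.\<close>

definition represents ::
  "nat \<Rightarrow> 'a::{comm_ring,comm_monoid_mult} ext list \<Rightarrow> 'a ext list \<Rightarrow> 'a mat
    \<Rightarrow> ('a ext \<Rightarrow> 'a ext) \<Rightarrow> bool" where
  "represents m B B' A g \<longleftrightarrow> A \<in> carrier_mat (length B') (length B) \<and>
     (\<forall>c\<in>carrier_vec (length B). g (ext_lincomb m c B) = ext_lincomb m (A *\<^sub>v c) B')"

end

theory Submission
  imports Defs
begin

text \<open>
  Work in the free algebra modulo the ideal \<open>J\<close> of the exterior algebra. Splitting off one basis
  vector \<open>y\<close> gives \<open>\<Lambda> = \<Lambda>' \<oplus> y \<and> \<Lambda>'\<close>, and for \<open>\<omega>, \<eta> \<in> \<Lambda>'\<close>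
  the map \<open>\<Phi>\<close> with coefficients \<open>u\<close> of \<open>y\<^sup>*\<close> and \<open>v\<close> of \<open>y\<close> satisfies
  \<open>\<Phi>(\<omega>) = v y \<and> \<omega> + \<Phi>'(\<omega>)\<close> and \<open>\<Phi>(y \<and> \<eta>) = u \<eta> - y \<and> \<Phi>'(\<eta>)\<close>. This is the block
  recursion of the Suslin matrices, since the conjugate of \<open>S(u, v)\<close> is the transpose of \<open>S(v, u)\<close>.
  With zero contraction the same computation shows that the basis monomials span. They are independent
  because contracting with \<open>y\<^sup>*\<close> isolates \<open>\<eta>\<close> in \<open>\<omega> + y \<and> \<eta>\<close>, and because the coefficient of the
  empty word vanishes on \<open>J\<close>.
\<close>

section \<open>The free algebra and its contractions\<close>

abbreviation word :: "'v list \<Rightarrow> 'v list \<Rightarrow>\<^sub>0 'a::{comm_ring,comm_monoid_mult}" where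
  "word w \<equiv> Poly_Mapping.single w 1"

abbreviation scalar :: "'a::{comm_ring,comm_monoid_mult} \<Rightarrow> 'v list \<Rightarrow>\<^sub>0 'a" where
  "scalar r \<equiv> Poly_Mapping.single [] r"

lemma single_mult_single:
  "Poly_Mapping.single v a * Poly_Mapping.single w b =
    (Poly_Mapping.single (v @ w) (a * b) :: 'v list \<Rightarrow>\<^sub>0 'a::semiring_0)"
  by (simp add: mult_single plus_list_def)

lemma sum_singles:
  fixes t :: "'v \<Rightarrow>\<^sub>0 'a::comm_monoid_add"
  assumes "finite A" "Poly_Mapping.keys t \<subseteq> A"
  shows "(\<Sum>w\<in>A. Poly_Mapping.single w (Poly_Mapping.lookup t w)) = t"
proof (rule poly_mapping_eqI)
  fix k
  have "Poly_Mapping.lookup (\<Sum>w\<in>A. Poly_Mapping.single w (Poly_Mapping.lookup t w)) k =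
      (\<Sum>w\<in>A. if w = k then Poly_Mapping.lookup t k else 0)"
    by (simp add: lookup_sum lookup_single when_def) (rule sum.cong, auto)
  also have "\<dots> = Poly_Mapping.lookup t k"
    using assms by (auto simp: in_keys_iff)
  finally show "Poly_Mapping.lookup (\<Sum>w\<in>A. Poly_Mapping.single w (Poly_Mapping.lookup t w)) k =
      Poly_Mapping.lookup t k" .
qed

text \<open>Reduces additive statements to single words. Restricting the base case to words in the
  support of \<open>t\<close> lets conditions on \<open>t\<close>, such as the letters or the parity
  of its words, pass to the summands.\<close>

lemma single_add_induct:
  fixes t :: "'v \<Rightarrow>\<^sub>0 'a::comm_monoid_add"
  assumes "\<And>w c. w \<in> Poly_Mapping.keys t \<Longrightarrow> P (Poly_Mapping.single w c)" and "P 0"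
    and "\<And>s t. P s \<Longrightarrow> P t \<Longrightarrow> P (s + t)"
  shows "P t"
proof -
  have "P (\<Sum>w\<in>A. Poly_Mapping.single w (Poly_Mapping.lookup t w))"
    if "finite A" "A \<subseteq> Poly_Mapping.keys t" for A
    using that by (induction A rule: finite_induct) (auto intro: assms)
  from this[of "Poly_Mapping.keys t"] show ?thesis
    by (simp add: sum_singles)
qed

lemma mult_word_Nil [simp]:
  "word [] * t = t" "t * word [] = (t :: 'v list \<Rightarrow>\<^sub>0 'a::{comm_ring,comm_monoid_mult})"
proof -
  show "word [] * t = t"
    by (rule single_add_induct[of t]) (simp_all add: single_mult_single distrib_left)
  show "t * word [] = t"
    by (rule single_add_induct[of t]) (simp_all add: single_mult_single distrib_right)
qed

lemma scalar_commute:
  "t * scalar r = scalar r * (t :: 'v list \<Rightarrow>\<^sub>0 'a::{comm_ring,comm_monoid_mult})"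
  by (rule single_add_induct[of t]) (simp_all add: single_mult_single distrib_left distrib_right mult.commute)

lemma scalar_left_commute:
  "s * (scalar r * t) = scalar r * (s * (t :: 'v list \<Rightarrow>\<^sub>0 'a::{comm_ring,comm_monoid_mult}))"
  by (metis scalar_commute mult.assoc)

section \<open>Contraction on the free algebra\<close>

lemma free_contract_superset:
  assumes "finite A" "Poly_Mapping.keys t \<subseteq> A"
  shows "free_contract \<phi> t =
     (\<Sum>w\<in>A. \<Sum>i<length w.
        Poly_Mapping.single (take i w @ drop (Suc i) w)
          (Poly_Mapping.lookup t w * ((- 1) ^ i * \<phi> (w ! i))))"
  unfolding free_contract_def
  by (rule sum.mono_neutral_left) (use assms in \<open>auto simp: in_keys_iff\<close>)

lemma free_contract_0 [simp]: "free_contract \<phi> 0 = 0"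
  by (simp add: free_contract_def)

lemma free_contract_add: "free_contract \<phi> (s + t) = free_contract \<phi> s + free_contract \<phi> t"
proof -
  \<comment> \<open>The sum defining \<open>free_contract\<close> runs over the support, which
    changes under addition; over the common finite index set \<open>?A\<close> additivity is
    termwise.\<close>
  let ?A = "Poly_Mapping.keys s \<union> Poly_Mapping.keys t"
  have "Poly_Mapping.keys (s + t) \<subseteq> ?A"
    by (rule keys_add)
  then show ?thesis
    by (simp add: free_contract_superset[of ?A] lookup_add distrib_right single_add sum.distrib)
qed

lemma free_contract_uminus: "free_contract \<phi> (- t) = - free_contract \<phi> t"
  by (metis add.right_inverse free_contract_0 free_contract_add minus_unique)

lemma free_contract_diff: "free_contract \<phi> (s - t) = free_contract \<phi> s - free_contract \<phi> t"
  by (metis add_uminus_conv_diff free_contract_add free_contract_uminus)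

lemma free_contract_single:
  "free_contract \<phi> (Poly_Mapping.single w c) =
     (\<Sum>i<length w. Poly_Mapping.single (take i w @ drop (Suc i) w) (c * ((- 1) ^ i * \<phi> (w ! i))))"
  by (subst free_contract_superset[of "{w}"]) auto

lemma free_contract_zero_form [simp]: "free_contract (\<lambda>_. 0) t = 0"
  by (simp add: free_contract_def)

lemma free_contract_scalar_mult: "free_contract \<phi> (scalar r * t) = scalar r * free_contract \<phi> t"
  by (rule single_add_induct[of t])
    (simp_all add: single_mult_single distrib_left free_contract_add free_contract_single
      sum_distrib_left mult.assoc)

text \<open>Leibniz rule for one letter. Deleting position 0 gives the term with
  \<open>\<phi> y\<close>; every later position of \<open>y # w\<close> is a position of
  \<open>w\<close> shifted by one, which flips its sign.\<close>

lemma free_contract_word_mult: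
  "free_contract \<phi> (word [y] * t) = scalar (\<phi> y) * t - word [y] * free_contract \<phi> t"
proof (rule single_add_induct[of t])
  fix w and c :: 'a
  show "free_contract \<phi> (word [y] * Poly_Mapping.single w c) =
      scalar (\<phi> y) * Poly_Mapping.single w c - word [y] * free_contract \<phi> (Poly_Mapping.single w c)"
    by (simp add: single_mult_single free_contract_single sum.lessThan_Suc_shift sum_distrib_left
        single_uminus sum_negf mult.commute del: sum.lessThan_Suc)
qed (simp_all add: distrib_left free_contract_add)

lemma free_contract_eq_0:
  assumes "\<And>w y. w \<in> Poly_Mapping.keys t \<Longrightarrow> y \<in> set w \<Longrightarrow> \<phi> y = 0"
  shows "free_contract \<phi> t = 0"
  unfolding free_contract_def by (intro sum.neutral ballI) (use assms in auto)

section \<open>The free algebra as a ring\<close>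

lemma free_alg_sel [simp]:
  "\<zero>\<^bsub>free_alg m\<^esub> = 0" "\<one>\<^bsub>free_alg m\<^esub> = word []"
  "s \<oplus>\<^bsub>free_alg m\<^esub> t = s + t" "s \<otimes>\<^bsub>free_alg m\<^esub> t = s * t"
  by (simp_all add: free_alg_def)

lemma free_alg_carrier_iff:
  "t \<in> carrier (free_alg m) \<longleftrightarrow> (\<forall>w\<in>Poly_Mapping.keys t. set w \<subseteq> carrier_vec m)"
  by (simp add: free_alg_def)

lemma free_alg_zero [simp]: "0 \<in> carrier (free_alg m)"
  by (simp add: free_alg_carrier_iff)

lemma free_alg_single [simp]:
  "set w \<subseteq> carrier_vec m \<Longrightarrow> Poly_Mapping.single w c \<in> carrier (free_alg m)"
  by (simp add: free_alg_carrier_iff)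

lemma free_alg_add [simp]:
  "s \<in> carrier (free_alg m) \<Longrightarrow> t \<in> carrier (free_alg m) \<Longrightarrow> s + t \<in> carrier (free_alg m)"
  using keys_add[of s t] by (auto simp: free_alg_carrier_iff)

lemma free_alg_uminus [simp]:
  "s \<in> carrier (free_alg m) \<Longrightarrow> - s \<in> carrier (free_alg m)"
  by (auto simp: free_alg_carrier_iff in_keys_iff)

lemma free_alg_diff [simp]:
  "s \<in> carrier (free_alg m) \<Longrightarrow> t \<in> carrier (free_alg m) \<Longrightarrow> s - t \<in> carrier (free_alg m)"
  using free_alg_add[of s m "- t"] by simp

lemma free_alg_mult [simp]:
  assumes "s \<in> carrier (free_alg m)" "t \<in> carrier (free_alg m)"
  shows "s * t \<in> carrier (free_alg m)"
  using assms keys_mult[of s t] by (fastforce simp: free_alg_carrier_iff plus_list_def)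

lemma free_alg_sum [simp]:
  "(\<And>i. i \<in> I \<Longrightarrow> t i \<in> carrier (free_alg m)) \<Longrightarrow> sum t I \<in> carrier (free_alg m)"
  by (induction I rule: infinite_finite_induct) auto

lemma free_alg_contract [simp]:
  assumes "t \<in> carrier (free_alg m)"
  shows "free_contract \<phi> t \<in> carrier (free_alg m)"
  unfolding free_contract_def
  by (intro free_alg_sum free_alg_single)
    (use assms in \<open>auto simp: free_alg_carrier_iff dest!: in_set_takeD in_set_dropD\<close>)

lemma ring_free_alg: "ring (free_alg m)"
proof (rule ringI)
  show "abelian_group (free_alg m :: 'a tens ring)"
  proof (rule abelian_groupI)
    fix t :: "'a tens" assume "t \<in> carrier (free_alg m)"
    then show "\<exists>s\<in>carrier (free_alg m). s \<oplus>\<^bsub>free_alg m\<^esub> t = \<zero>\<^bsub>free_alg m\<^esub>"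
      by (intro bexI[of _ "- t"]) auto
  qed (simp_all add: add_ac)
  show "monoid (free_alg m :: 'a tens ring)"
    by (rule monoidI) (simp_all add: mult.assoc)
qed (simp_all add: distrib_left distrib_right)

lemma free_alg_minus:
  assumes "s \<in> carrier (free_alg m)" "t \<in> carrier (free_alg m)"
  shows "s \<ominus>\<^bsub>free_alg m\<^esub> t = s - t"
proof -
  interpret ring "free_alg m :: 'a tens ring" by (rule ring_free_alg)
  have "\<ominus>\<^bsub>free_alg m\<^esub> t = - t"
    by (rule minus_equality) (use assms in simp_all)
  then show ?thesis by (simp add: a_minus_def)
qed

section \<open>The ideal of the exterior relations\<close>

lemma ext_relations_carrier: "ext_relations m \<subseteq> carrier (free_alg m)"
  by (auto simp: ext_relations_def)

lemma ideal_ext_ideal: "ideal (ext_ideal m) (free_alg m)"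
  unfolding ext_ideal_def
  by (rule ring.genideal_ideal[OF ring_free_alg ext_relations_carrier])

lemma ext_ideal_carrier: "t \<in> ext_ideal m \<Longrightarrow> t \<in> carrier (free_alg m)"
  using ideal.Icarr[OF ideal_ext_ideal] .

lemma ext_ideal_relation: "t \<in> ext_relations m \<Longrightarrow> t \<in> ext_ideal m"
  unfolding ext_ideal_def using ring.genideal_self[OF ring_free_alg ext_relations_carrier] by blast

lemma ext_ideal_mult_left:
  "s \<in> carrier (free_alg m) \<Longrightarrow> t \<in> ext_ideal m \<Longrightarrow> s * t \<in> ext_ideal m"
  using ideal.I_l_closed[OF ideal_ext_ideal, of t m s] by simp

lemma ext_ideal_mult_right:
  "s \<in> carrier (free_alg m) \<Longrightarrow> t \<in> ext_ideal m \<Longrightarrow> t * s \<in> ext_ideal m"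
  using ideal.I_r_closed[OF ideal_ext_ideal, of t m s] by simp

lemma ext_ideal_zero [simp]: "0 \<in> ext_ideal m"
  using additive_subgroup.zero_closed[OF ideal.axioms(1)[OF ideal_ext_ideal], of m] by simp

lemma ext_ideal_add: "s \<in> ext_ideal m \<Longrightarrow> t \<in> ext_ideal m \<Longrightarrow> s + t \<in> ext_ideal m"
  using additive_subgroup.a_closed[OF ideal.axioms(1)[OF ideal_ext_ideal], of s m t] by simp

lemma ext_ideal_uminus:
  assumes "t \<in> ext_ideal m"
  shows "- t \<in> ext_ideal m"
proof -
  have "(- word []) * t \<in> ext_ideal m"
    by (intro ext_ideal_mult_left assms free_alg_uminus) simp
  then show ?thesis by simp
qed

lemma ext_ideal_diff: "s \<in> ext_ideal m \<Longrightarrow> t \<in> ext_ideal m \<Longrightarrow> s - t \<in> ext_ideal m"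
  using ext_ideal_add[of s m "- t"] by (simp add: ext_ideal_uminus)

lemma ext_ideal_minimal:
  assumes "ideal I (free_alg m)" "ext_relations m \<subseteq> I"
  shows "ext_ideal m \<subseteq> I"
  unfolding ext_ideal_def by (rule ring.genideal_minimal[OF ring_free_alg assms])

section \<open>Arithmetic of cosets\<close>

lemma ext_class_eq_iff:
  assumes "s \<in> carrier (free_alg m)" "t \<in> carrier (free_alg m)"
  shows "ext_class m s = ext_class m t \<longleftrightarrow> s - t \<in> ext_ideal m"
  using ring.quotient_eq_iff_same_a_r_cos[OF ring_free_alg ideal_ext_ideal assms]
  by (simp add: ext_class_def free_alg_minus[OF assms])

lemma ext_class_hom:
  "ring_hom_ring (free_alg m) (ext_alg m)
    (ext_class m :: 'a::{comm_ring,comm_monoid_mult} tens \<Rightarrow> 'a ext)"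
proof -
  have "(ext_class m :: 'a tens \<Rightarrow> 'a ext) = (+>\<^bsub>free_alg m\<^esub>) (ext_ideal m)"
    by (simp add: ext_class_def fun_eq_iff)
  then show ?thesis
    using ideal.rcos_ring_hom_ring[OF ideal_ext_ideal, of m] by (simp add: ext_alg_def)
qed

lemma ext_class_add:
  "s \<in> carrier (free_alg m) \<Longrightarrow> t \<in> carrier (free_alg m) \<Longrightarrow>
    ext_class m s \<oplus>\<^bsub>ext_alg m\<^esub> ext_class m t = ext_class m (s + t)"
  using ring_hom_add[OF ring_hom_ring.homh[OF ext_class_hom], of s m t] by simp

lemma ext_class_mult:
  "s \<in> carrier (free_alg m) \<Longrightarrow> t \<in> carrier (free_alg m) \<Longrightarrow>
    ext_class m s \<otimes>\<^bsub>ext_alg m\<^esub> ext_class m t = ext_class m (s * t)"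
  using ring_hom_mult[OF ring_hom_ring.homh[OF ext_class_hom], of s m t] by simp

lemma ext_class_carrier:
  "s \<in> carrier (free_alg m) \<Longrightarrow> ext_class m s \<in> carrier (ext_alg m)"
  using ring_hom_closed[OF ring_hom_ring.homh[OF ext_class_hom]] .

lemma ext_class_sum:
  fixes t :: "'i \<Rightarrow> 'a::{comm_ring,comm_monoid_mult} tens"
  assumes "finite I" "\<And>i. i \<in> I \<Longrightarrow> t i \<in> carrier (free_alg m)"
  shows "(\<Oplus>\<^bsub>ext_alg m\<^esub>i\<in>I. ext_class m (t i)) = ext_class m (sum t I)"
proof -
  interpret ring_hom_ring "free_alg m :: 'a tens ring" "ext_alg m" "ext_class m"
    by (rule ext_class_hom)
  show ?thesis
    using assms
  proof (induction I rule: finite_induct)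
    case empty
    then show ?case using hom_zero by simp
  next
    case (insert i I)
    then show ?case
      by (subst S.finsum_insert) (auto simp: ext_class_add intro!: ext_class_carrier)
  qed
qed

text \<open>Right multiples are built into \<open>?K\<close> so that the Leibniz rule for left multiplication by a
  single vector suffices; the general rule would need the grading involution.\<close>

lemma free_contract_ext_ideal:
  fixes \<phi> :: "'a::{comm_ring,comm_monoid_mult} vec \<Rightarrow> 'a"
  assumes add: "\<And>x y. x \<in> carrier_vec m \<Longrightarrow> y \<in> carrier_vec m \<Longrightarrow> \<phi> (x + y) = \<phi> x + \<phi> y"
    and smult: "\<And>r x. x \<in> carrier_vec m \<Longrightarrow> \<phi> (r \<cdot>\<^sub>v x) = r * \<phi> x"
    and t: "t \<in> ext_ideal m"
  shows "free_contract \<phi> t \<in> ext_ideal m"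
proof -
  let ?F = "free_alg m :: 'a tens ring" and ?J = "ext_ideal m :: 'a tens set"
  let ?K = "{t \<in> ?J. \<forall>s\<in>carrier ?F. free_contract \<phi> (t * s) \<in> ?J}"
  interpret F: ring ?F by (rule ring_free_alg)
  \<comment> \<open>This is what closes \<open>?K\<close> under left multiplication. Additivity
    reduces \<open>s\<close> to a word, whose letters are then peeled off by the Leibniz rule; the
    right factor \<open>s'\<close> is carried along because membership in \<open>?K\<close>
    quantifies over it.\<close>
  have left: "free_contract \<phi> (s * t * s') \<in> ?J"
    if "s \<in> carrier ?F" "t \<in> ?K" "s' \<in> carrier ?F" for s t s'
  proof (rule single_add_induct[of s])
    fix w c assume "w \<in> Poly_Mapping.keys s"
    with that(1) have "set w \<subseteq> carrier_vec m" by (auto simp: free_alg_carrier_iff)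
    then have "free_contract \<phi> (word w * (t * s')) \<in> ?J"
    proof (induction w)
      case Nil
      then show ?case using that by simp
    next
      case (Cons y w)
      have eq: "word (y # w) = (word [y] * word w :: 'a tens)"
        by (simp add: single_mult_single)
      have "scalar (\<phi> y) * (word w * (t * s')) \<in> ?J"
        using Cons that by (intro ext_ideal_mult_left ext_ideal_mult_right) auto
      moreover have "word [y] * free_contract \<phi> (word w * (t * s')) \<in> ?J"
        using Cons by (intro ext_ideal_mult_left) auto
      ultimately show ?case
        by (simp add: eq mult.assoc free_contract_word_mult ext_ideal_diff)
    qed
    then have "scalar c * free_contract \<phi> (word w * (t * s')) \<in> ?J"
      by (intro ext_ideal_mult_left) auto
    moreover have "Poly_Mapping.single w c = scalar c * word w"
      by (simp add: single_mult_single)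
    ultimately show "free_contract \<phi> (Poly_Mapping.single w c * t * s') \<in> ?J"
      by (simp add: mult.assoc free_contract_scalar_mult)
  qed (simp_all add: distrib_right free_contract_add ext_ideal_add)
  have "ideal ?K ?F"
  proof (rule idealI[OF ring_free_alg])
    show "subgroup ?K (add_monoid ?F)"
    proof (rule F.add.subgroupI)
      show "?K \<noteq> {}" by (auto intro!: exI[of _ 0])
      fix s assume s: "s \<in> ?K"
      then have "\<ominus>\<^bsub>?F\<^esub> s = - s"
        by (intro F.minus_equality) (auto intro: ext_ideal_carrier free_alg_uminus)
      then show "\<ominus>\<^bsub>?F\<^esub> s \<in> ?K"
        using s by (auto simp: ext_ideal_uminus free_contract_uminus)
    qed (auto intro: ext_ideal_carrier simp: ext_ideal_add distrib_right free_contract_add)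
  qed (use left in \<open>auto intro: ext_ideal_mult_left ext_ideal_mult_right simp: mult.assoc\<close>)
  moreover have "ext_relations m \<subseteq> ?K"
  proof
    fix t :: "'a tens" assume t: "t \<in> ext_relations m"
    then have tJ: "t \<in> ?J" by (rule ext_ideal_relation)
    have "free_contract \<phi> (t * s) \<in> ?J" if s: "s \<in> carrier ?F" for s
    proof -
      have *: "t * free_contract \<phi> s \<in> ?J"
        using tJ s by (intro ext_ideal_mult_right) auto
      from t consider
        (add) x y where "x \<in> carrier_vec m" "y \<in> carrier_vec m" "t = word [x + y] - word [x] - word [y]"
        | (smult) r x where "x \<in> carrier_vec m" "t = word [r \<cdot>\<^sub>v x] - Poly_Mapping.single [x] r"
        | (square) x where "x \<in> carrier_vec m" "t = word [x, x]"
        unfolding ext_relations_def by blast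
      then show ?thesis
      proof cases
        \<comment> \<open>In this case and the next, linearity of \<open>\<phi>\<close> cancels the
          scalar terms of the Leibniz rule, and only a multiple of \<open>t\<close> itself
          survives.\<close>
        case add
        then have "free_contract \<phi> (t * s) = - (t * free_contract \<phi> s)"
          by (simp add: left_diff_distrib free_contract_diff free_contract_word_mult
              assms(1) single_add distrib_right)
        then show ?thesis using * by (simp add: ext_ideal_uminus)
      next
        case smult
        have "Poly_Mapping.single [x] r = scalar r * word [x]"
          by (simp add: single_mult_single)
        moreover have "scalar r * (scalar (\<phi> x) * s) = scalar (r * \<phi> x) * s"
          by (simp add: mult.assoc[symmetric] single_mult_single)
        ultimately have "free_contract \<phi> (t * s) = - (t * free_contract \<phi> s)"
          using smult assms(2)
          by (simp add: left_diff_distrib free_contract_diff free_contract_word_mult mult.assoc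
              free_contract_scalar_mult right_diff_distrib)
        then show ?thesis using * by (simp add: ext_ideal_uminus)
      next
        \<comment> \<open>Applying the Leibniz rule twice produces the term
          \<open>scalar (\<phi> x) * (word [x] * s)\<close> with both signs, so again only a
          multiple of \<open>t\<close> remains.\<close>
        case square
        have "t = word [x] * word [x]"
          by (simp add: square single_mult_single)
        then have "free_contract \<phi> (t * s) = t * free_contract \<phi> s"
          by (simp add: mult.assoc free_contract_word_mult right_diff_distrib scalar_left_commute)
        then show ?thesis using * by simp
      qed
    qed
    with tJ show "t \<in> ?K" by simp
  qed
  ultimately have "ext_ideal m \<subseteq> ?K" by (rule ext_ideal_minimal)
  with t have "t \<in> ?K" by blast
  then have "\<forall>s\<in>carrier ?F. free_contract \<phi> (t * s) \<in> ?J" by simp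
  from bspec[OF this, of "word []"] show ?thesis by simp
qed

text \<open>The coefficient of the empty word is multiplicative, since a concatenation is empty only
  if both factors are. Its kernel is therefore an ideal, and it contains the relations because they
  involve nonempty words only.\<close>

lemma lookup_Nil_ext_ideal:
  fixes t :: "'a::{comm_ring,comm_monoid_mult} tens"
  assumes "t \<in> ext_ideal m"
  shows "Poly_Mapping.lookup t [] = 0"
proof -
  let ?F = "free_alg m :: 'a tens ring"
  let ?K = "{t \<in> carrier ?F. Poly_Mapping.lookup t [] = 0}"
  interpret F: ring ?F by (rule ring_free_alg)
  have mult: "Poly_Mapping.lookup (s * t) [] = Poly_Mapping.lookup s [] * Poly_Mapping.lookup t []"
    for s t :: "'a tens"
  proof (rule single_add_induct[of s])
    fix v and a :: 'a
    show "Poly_Mapping.lookup (Poly_Mapping.single v a * t) [] =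
        Poly_Mapping.lookup (Poly_Mapping.single v a) [] * Poly_Mapping.lookup t []"
      by (rule single_add_induct[of t])
        (auto simp: single_mult_single lookup_single when_def distrib_left lookup_add)
  qed (simp_all add: distrib_right lookup_add)
  have "ideal ?K ?F"
  proof (rule idealI[OF ring_free_alg])
    show "subgroup ?K (add_monoid ?F)"
    proof (rule F.add.subgroupI)
      show "?K \<noteq> {}" by (auto intro!: exI[of _ 0])
      fix s assume s: "s \<in> ?K"
      then have "\<ominus>\<^bsub>?F\<^esub> s = - s"
        by (intro F.minus_equality) auto
      then show "\<ominus>\<^bsub>?F\<^esub> s \<in> ?K"
        using s by auto
    qed (auto simp: lookup_add)
  qed (auto simp: mult)
  moreover have "ext_relations m \<subseteq> ?K"
    by (auto simp: ext_relations_def lookup_minus lookup_single)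
  ultimately show ?thesis
    using assms ext_ideal_minimal by blast
qed

section \<open>Monomials in basis vectors\<close>

text \<open>The order of the monomials is the one dictated by the blocks of the Suslin matrices.\<close>

fun even_words :: "'v list \<Rightarrow> 'v list list" and odd_words :: "'v list \<Rightarrow> 'v list list" where
  "even_words [] = [[]]"
| "odd_words [] = []"
| "even_words (y # ys) = even_words ys @ map ((#) y) (odd_words ys)"
| "odd_words (y # ys) = map ((#) y) (even_words ys) @ odd_words ys"

text \<open>Stated for nonempty lists: for \<open>[]\<close> the two lengths are 1 and 0. The joint
  statement is needed because each recursion uses both lists.\<close>

lemma length_even_odd_words:
  "length (even_words (y # ys)) = 2 ^ length ys \<and> length (odd_words (y # ys)) = 2 ^ length ys"
  by (induction ys arbitrary: y) auto

lemma length_words [simp]: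
  assumes "length ys = Suc k"
  shows "length (even_words ys) = 2 ^ k" "length (odd_words ys) = 2 ^ k"
  using assms length_even_odd_words[of "hd ys" "tl ys"] by (cases ys; simp)+

lemma set_words:
  "w \<in> set (even_words ys) \<Longrightarrow> set w \<subseteq> set ys \<and> even (length w)"
  "w \<in> set (odd_words ys) \<Longrightarrow> set w \<subseteq> set ys \<and> odd (length w)"
proof -
  have "(\<forall>w\<in>set (even_words ys). set w \<subseteq> set ys \<and> even (length w)) \<and>
      (\<forall>w\<in>set (odd_words ys). set w \<subseteq> set ys \<and> odd (length w))"
    by (induction ys) (auto, blast+)
  then show "w \<in> set (even_words ys) \<Longrightarrow> set w \<subseteq> set ys \<and> even (length w)"
    and "w \<in> set (odd_words ys) \<Longrightarrow> set w \<subseteq> set ys \<and> odd (length w)"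
    by blast+
qed

text \<open>A representative in the free algebra of the linear combination that
  \<open>ext_lincomb\<close> forms from the classes of the words. It keeps coordinate computations
  on the level of representatives.\<close>

definition word_comb ::
  "'a::{comm_ring,comm_monoid_mult} vec \<Rightarrow> 'v list list \<Rightarrow> 'v list \<Rightarrow>\<^sub>0 'a" where
  "word_comb c ws = (\<Sum>i<length ws. Poly_Mapping.single (ws ! i) (c $ i))"

lemma word_comb_append:
  assumes "dim_vec c = length ws" "dim_vec d = length vs"
  shows "word_comb (c @\<^sub>v d) (ws @ vs) = word_comb c ws + word_comb d vs"
proof -
  let ?f = "\<lambda>i. Poly_Mapping.single ((ws @ vs) ! i) ((c @\<^sub>v d) $ i)"
  have "sum ?f {..<length ws + n} = sum ?f {..<length ws} + (\<Sum>i<n. ?f (length ws + i))" for n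
    by (induction n) (simp_all add: add.assoc)
  from this[of "length vs"] show ?thesis
    using assms by (simp add: word_comb_def nth_append)
qed

lemma word_comb_map_Cons:
  "word_comb c (map ((#) y) ws) = word [y] * word_comb c ws"
  by (simp add: word_comb_def sum_distrib_left single_mult_single)

lemma word_comb_add:
  "dim_vec d = length ws \<Longrightarrow> word_comb (c + d) ws = word_comb c ws + word_comb d ws"
  by (simp add: word_comb_def single_add sum.distrib)

lemma word_comb_smult:
  "dim_vec c = length ws \<Longrightarrow> word_comb (r \<cdot>\<^sub>v c) ws = scalar r * word_comb c ws"
  by (simp add: word_comb_def sum_distrib_left single_mult_single)

lemma word_comb_uminus:
  "dim_vec c = length ws \<Longrightarrow> word_comb (- c) ws = - word_comb c ws"
  by (simp add: word_comb_def single_uminus sum_negf)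

lemma word_comb_diff:
  "dim_vec d = length ws \<Longrightarrow> word_comb (c - d) ws = word_comb c ws - word_comb d ws"
  by (simp add: word_comb_def single_diff sum_subtractf)

lemma word_comb_0 [simp]: "word_comb (0\<^sub>v (length ws)) ws = 0"
  by (simp add: word_comb_def)

lemma keys_sum_subset:
  "Poly_Mapping.keys (sum f A) \<subseteq> (\<Union>i\<in>A. Poly_Mapping.keys (f i :: 'v \<Rightarrow>\<^sub>0 'a::comm_monoid_add))"
proof (induction A rule: infinite_finite_induct)
  case (insert x A)
  then show ?case using keys_add[of "f x" "sum f A"] by auto
qed auto

lemma keys_word_comb: "Poly_Mapping.keys (word_comb c ws) \<subseteq> set ws"
proof -
  have "Poly_Mapping.keys (word_comb c ws) \<subseteq>
      (\<Union>i<length ws. Poly_Mapping.keys (Poly_Mapping.single (ws ! i) (c $ i)))"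
    unfolding word_comb_def by (rule keys_sum_subset)
  also have "\<dots> \<subseteq> set ws" by (auto split: if_splits)
  finally show ?thesis .
qed

lemma word_comb_carrier:
  assumes "set ys \<subseteq> carrier_vec m"
  shows "word_comb c (even_words ys) \<in> carrier (free_alg m)"
    and "word_comb c (odd_words ys) \<in> carrier (free_alg m)"
proof -
  have "set w \<subseteq> carrier_vec m"
    if "w \<in> set (even_words ys) \<or> w \<in> set (odd_words ys)" for w
    using that assms set_words[of w ys] by auto
  then show "word_comb c (even_words ys) \<in> carrier (free_alg m)"
    and "word_comb c (odd_words ys) \<in> carrier (free_alg m)"
    using keys_word_comb[of c] unfolding free_alg_carrier_iff by (meson subsetD)+
qed

section \<open>Suslin matrices: size, conjugation and block action\<close>

lemma suslin_carrier [simp]: "suslin (Suc k) u v \<in> carrier_mat (2 ^ k) (2 ^ k)"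
proof (induction k arbitrary: u v)
  case (Suc k)
  then show ?case
    using four_block_carrier_mat[of "u $ 0 \<cdot>\<^sub>m 1\<^sub>m (2 ^ k)" "2 ^ k" "2 ^ k" "v $ 0 \<cdot>\<^sub>m 1\<^sub>m (2 ^ k)" "2 ^ k" "2 ^ k"]
    by (simp add: Let_def mult_2)
qed simp

lemma dim_suslin [simp]:
  "dim_row (suslin (Suc k) u v) = 2 ^ k" "dim_col (suslin (Suc k) u v) = 2 ^ k"
  using suslin_carrier[of k u v] by (simp_all only: carrier_matD)

text \<open>Exchanging the arguments exchanges the two diagonal entries, and transposing turns the
  off-diagonal blocks of \<open>suslin\<close> into those of \<open>suslin_bar\<close>. Both have
  blocks built from the smaller \<open>suslin\<close>, so a case distinction suffices.\<close>

lemma suslin_bar_transpose: "suslin_bar (Suc k) u v = transpose_mat (suslin (Suc k) v u)"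
proof (cases k)
  case 0
  show ?thesis unfolding 0 by (rule eq_matI) simp_all
next
  case (Suc l)
  show ?thesis
    unfolding Suc suslin.simps suslin_bar.simps Let_def
    by (rule eq_matI) (auto simp: not_less)
qed

lemma suslin_bar_carrier [simp]: "suslin_bar (Suc k) u v \<in> carrier_mat (2 ^ k) (2 ^ k)"
  by (simp add: suslin_bar_transpose)

lemma scalar_mat_mult_vec:
  assumes "(c :: 'a::{comm_ring,comm_monoid_mult} vec) \<in> carrier_vec N"
  shows "(a \<cdot>\<^sub>m 1\<^sub>m N) *\<^sub>v c = a \<cdot>\<^sub>v c"
proof (rule eq_vecI)
  fix i assume "i < dim_vec (a \<cdot>\<^sub>v c)"
  with assms have i: "i < N" by simp
  have "((a \<cdot>\<^sub>m 1\<^sub>m N) *\<^sub>v c) $ i = (\<Sum>j<N. (a * (if i = j then 1 else 0)) * c $ j)"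
    using assms i by (simp add: scalar_prod_def lessThan_atLeast0)
  also have "\<dots> = (\<Sum>j<N. if i = j then a * c $ j else 0)"
    by (rule sum.cong) auto
  also have "\<dots> = (a \<cdot>\<^sub>v c) $ i"
    using i assms by simp
  finally show "((a \<cdot>\<^sub>m 1\<^sub>m N) *\<^sub>v c) $ i = (a \<cdot>\<^sub>v c) $ i" .
qed (use assms in simp)

text \<open>With the transposed block read as a smaller \<open>suslin_bar\<close>, the two families
  recur into each other. This is the form in which the recursion is compared with the map on the two
  halves of the exterior algebra.\<close>

lemma suslin_mult_vec:
  fixes u v :: "'a::{comm_ring,comm_monoid_mult} vec"
  assumes "c \<in> carrier_vec (2 ^ k)" "d \<in> carrier_vec (2 ^ k)"
  defines "u' \<equiv> vec_last u (Suc k)" and "v' \<equiv> vec_last v (Suc k)"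
  shows "suslin (Suc (Suc k)) u v *\<^sub>v (c @\<^sub>v d) =
      (u $ 0 \<cdot>\<^sub>v c + suslin (Suc k) u' v' *\<^sub>v d) @\<^sub>v (- (suslin_bar (Suc k) u' v' *\<^sub>v c) + v $ 0 \<cdot>\<^sub>v d)"
    and "suslin_bar (Suc (Suc k)) u v *\<^sub>v (c @\<^sub>v d) =
      (v $ 0 \<cdot>\<^sub>v c + - (suslin (Suc k) u' v' *\<^sub>v d)) @\<^sub>v (suslin_bar (Suc k) u' v' *\<^sub>v c + u $ 0 \<cdot>\<^sub>v d)"
proof -
  note block = four_block_mat_mult_vec[of _ "2 ^ k" "2 ^ k" _ "2 ^ k" _ "2 ^ k"]
  have 1: "- transpose_mat (suslin (Suc k) v' u') *\<^sub>v c = - (suslin_bar (Suc k) u' v' *\<^sub>v c)"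
    "- suslin (Suc k) u' v' *\<^sub>v d = - (suslin (Suc k) u' v' *\<^sub>v d)"
    using assms(1,2) by (simp_all add: suslin_bar_transpose)
  show "suslin (Suc (Suc k)) u v *\<^sub>v (c @\<^sub>v d) =
      (u $ 0 \<cdot>\<^sub>v c + suslin (Suc k) u' v' *\<^sub>v d) @\<^sub>v (- (suslin_bar (Suc k) u' v' *\<^sub>v c) + v $ 0 \<cdot>\<^sub>v d)"
    unfolding suslin.simps Let_def u'_def[symmetric] v'_def[symmetric]
    by (subst block) (use assms(1,2) in \<open>simp_all add: 1 scalar_mat_mult_vec\<close>)
  show "suslin_bar (Suc (Suc k)) u v *\<^sub>v (c @\<^sub>v d) =
      (v $ 0 \<cdot>\<^sub>v c + - (suslin (Suc k) u' v' *\<^sub>v d)) @\<^sub>v (suslin_bar (Suc k) u' v' *\<^sub>v c + u $ 0 \<cdot>\<^sub>v d)"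
    unfolding suslin_bar.simps Let_def u'_def[symmetric] v'_def[symmetric]
    by (subst block) (use assms(1,2) in \<open>simp_all add: 1 scalar_mat_mult_vec suslin_bar_transpose\<close>)
qed

section \<open>Anticommutation and the Clifford operator\<close>

lemma ext_ideal_word_add:
  "x \<in> carrier_vec m \<Longrightarrow> y \<in> carrier_vec m \<Longrightarrow>
    word [x + y] - word [x] - word [y] \<in> ext_ideal m"
  by (rule ext_ideal_relation) (auto simp: ext_relations_def)

lemma ext_ideal_word_smult:
  "x \<in> carrier_vec m \<Longrightarrow> word [r \<cdot>\<^sub>v x] - Poly_Mapping.single [x] r \<in> ext_ideal m"
  by (rule ext_ideal_relation) (auto simp: ext_relations_def)

lemma ext_ideal_square: "y \<in> carrier_vec m \<Longrightarrow> word [y] * word [y] \<in> ext_ideal m"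
  by (rule ext_ideal_relation) (auto simp: ext_relations_def single_mult_single)

text \<open>Polarisation of the square relation at \<open>y + z\<close>.\<close>

lemma ext_ideal_anticommute:
  assumes "y \<in> carrier_vec m" "z \<in> carrier_vec m"
  shows "word [y] * word [z] + word [z] * word [y] \<in> ext_ideal m"
proof -
  let ?A = "word [y + z]" and ?B = "word [y] + word [z]"
  have yz: "y + z \<in> carrier_vec m" using assms by simp
  have AB: "?A - ?B \<in> ext_ideal m"
    using ext_ideal_word_add[OF assms] by (simp add: diff_diff_eq)
  \<comment> \<open>In the free algebra the letter \<open>y + z\<close> is only congruent to the sum
    \<open>?B\<close> of two letters. The two correction terms replace \<open>?A * ?A\<close> by
    \<open>?B * ?B\<close> inside the ideal.\<close>
  have "?A * ?A - ?A * (?A - ?B) - (?A - ?B) * ?B - word [y] * word [y] - word [z] * word [z] \<in> ext_ideal m"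
    by (intro ext_ideal_diff ext_ideal_square ext_ideal_mult_left ext_ideal_mult_right AB assms yz)
      (use assms in auto)
  also have "?A * ?A - ?A * (?A - ?B) - (?A - ?B) * ?B = ?B * ?B"
    by (simp add: left_diff_distrib right_diff_distrib)
  also have "?B * ?B - word [y] * word [y] - word [z] * word [z] =
      word [y] * word [z] + word [z] * word [y]"
    by (simp add: distrib_left distrib_right)
  finally show ?thesis .
qed

text \<open>The vector with coordinates \<open>v\<close> in the frame \<open>ys\<close>, as a
  combination of one-letter words. Unlike the single letter for that vector, it splits along
  \<open>y # zs\<close> by an equality in the free algebra.\<close>

definition vec_comb :: "'v list \<Rightarrow> 'a::{comm_ring,comm_monoid_mult} vec \<Rightarrow> 'v list \<Rightarrow>\<^sub>0 'a" where
  "vec_comb ys v = (\<Sum>j<length ys. Poly_Mapping.single [ys ! j] (v $ j))"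

lemma vec_comb_carrier [simp]:
  "set ys \<subseteq> carrier_vec m \<Longrightarrow> vec_comb ys v \<in> carrier (free_alg m)"
  unfolding vec_comb_def by (intro free_alg_sum free_alg_single) auto

lemma vec_comb_anticommute:
  assumes "y \<in> carrier_vec m" "set ys \<subseteq> carrier_vec m"
  shows "word [y] * vec_comb ys v + vec_comb ys v * word [y] \<in> ext_ideal m"
proof -
  have "(\<Sum>j<l. scalar (v $ j) * (word [y] * word [ys ! j] + word [ys ! j] * word [y])) \<in> ext_ideal m"
    if "l \<le> length ys" for l
    using that
  proof (induction l)
    case (Suc l)
    then have "ys ! l \<in> carrier_vec m" using assms(2) by (simp add: subset_iff)
    with Suc assms(1) show ?case
      unfolding sum.lessThan_Suc
      by (intro ext_ideal_add ext_ideal_mult_left ext_ideal_anticommute free_alg_single) auto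
  qed simp
  from this[of "length ys"] show ?thesis
    by (simp add: vec_comb_def sum_distrib_left sum_distrib_right sum.distrib distrib_left single_mult_single)
qed

text \<open>The map \<open>Phi\<close> on representatives, with the multiplying vector given by its
  coordinates in a frame and the form left arbitrary.\<close>

definition clifford :: "('a vec \<Rightarrow> 'a) \<Rightarrow> 'a vec list \<Rightarrow> 'a vec \<Rightarrow>
    'a::{comm_ring,comm_monoid_mult} tens \<Rightarrow> 'a tens" where
  "clifford \<phi> ys v t = vec_comb ys v * t + free_contract \<phi> t"

lemma vec_comb_Cons:
  "dim_vec v = Suc (length zs) \<Longrightarrow>
    vec_comb (y # zs) v = scalar (v $ 0) * word [y] + vec_comb zs (vec_last v (length zs))"
  by (simp add: vec_comb_def vec_last_def single_mult_single sum.lessThan_Suc_shift del: sum.lessThan_Suc)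

lemma clifford_Cons:
  assumes "dim_vec v = Suc (length zs)"
  shows "clifford \<phi> (y # zs) v t =
    scalar (v $ 0) * (word [y] * t) + clifford \<phi> zs (vec_last v (length zs)) t"
  by (simp add: clifford_def vec_comb_Cons[OF assms] distrib_right mult.assoc)

text \<open>The vector part anticommutes with \<open>y\<close> modulo the ideal, and the contraction
  part does so up to the scalar \<open>\<phi> y\<close> by the Leibniz rule.\<close>

lemma clifford_word_mult:
  assumes "y \<in> carrier_vec m" "set zs \<subseteq> carrier_vec m" "t \<in> carrier (free_alg m)"
  shows "clifford \<phi> zs v (word [y] * t) - (scalar (\<phi> y) * t - word [y] * clifford \<phi> zs v t)
    \<in> ext_ideal m"
proof -
  have "(word [y] * vec_comb zs v + vec_comb zs v * word [y]) * t \<in> ext_ideal m"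
    using assms by (intro ext_ideal_mult_right vec_comb_anticommute)
  then show ?thesis
    by (simp add: clifford_def free_contract_word_mult algebra_simps)
qed

text \<open>Induction along the frame: its first vector supplies the outer blocks, the remaining
  ones the smaller matrices. The entries of \<open>u\<close> are the values of \<open>\<phi>\<close>
  on the frame. Since this is a congruence of representatives, it is available before the monomials
  are known to form a basis, and it also serves to show that they span.\<close>

lemma clifford_suslin:
  fixes u v :: "'a::{comm_ring,comm_monoid_mult} vec"
  assumes "set ys \<subseteq> carrier_vec m" "length ys = Suc k"
    and "u \<in> carrier_vec (Suc k)" "v \<in> carrier_vec (Suc k)"
    and "\<And>j. j < Suc k \<Longrightarrow> \<phi> (ys ! j) = u $ j" and "c \<in> carrier_vec (2 ^ k)"
  shows "clifford \<phi> ys v (word_comb c (odd_words ys))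
      - word_comb (suslin (Suc k) u v *\<^sub>v c) (even_words ys) \<in> ext_ideal m \<and>
    clifford \<phi> ys v (word_comb c (even_words ys))
      - word_comb (suslin_bar (Suc k) u v *\<^sub>v c) (odd_words ys) \<in> ext_ideal m"
  using assms
proof (induction k arbitrary: ys u v c)
  case 0
  then obtain y where ys: "ys = [y]" by (auto simp: length_Suc_conv)
  with 0 have y: "y \<in> carrier_vec m" and \<phi>: "\<phi> y = u $ 0" by auto
  \<comment> \<open>The only discrepancy in the base case: the odd word \<open>[y]\<close> produces
    a square, while for the even word \<open>[]\<close> both sides agree exactly.\<close>
  have "scalar (v $ 0 * c $ 0) * (word [y] * word [y]) \<in> ext_ideal m"
    by (intro ext_ideal_mult_left ext_ideal_square y) simp
  then show ?case
    using 0 by (simp add: ys \<phi> clifford_def vec_comb_def word_comb_def single_mult_single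
        free_contract_single scalar_prod_def mult.commute)
next
  case (Suc k)
  then obtain y zs where ys: "ys = y # zs" and zs: "length zs = Suc k"
    by (auto simp: length_Suc_conv)
  define u' v' where uv': "u' = vec_last u (Suc k)" "v' = vec_last v (Suc k)"
  define c1 c2 where c12: "c1 = vec_first c (2 ^ k)" "c2 = vec_last c (2 ^ k)"
  have c: "c = c1 @\<^sub>v c2" and cc: "c1 \<in> carrier_vec (2 ^ k)" "c2 \<in> carrier_vec (2 ^ k)"
    using Suc.prems(6) by (simp_all add: c12 mult_2)
  have y: "y \<in> carrier_vec m" and zm: "set zs \<subseteq> carrier_vec m" and \<phi>: "\<phi> y = u $ 0"
    using Suc.prems(1) Suc.prems(5)[of 0] by (auto simp: ys)
  have v: "dim_vec v = Suc (length zs)" using Suc.prems(4) zs by simp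
  have \<phi>': "\<phi> (zs ! j) = u' $ j" if "j < Suc k" for j
    using Suc.prems(3) Suc.prems(5)[of "Suc j"] that by (simp add: ys uv' vec_last_def)
  have uvc: "u' \<in> carrier_vec (Suc k)" "v' \<in> carrier_vec (Suc k)" by (simp_all add: uv')
  \<comment> \<open>In both word lists the first half of \<open>c\<close> belongs to the even words
    of \<open>zs\<close> and the second half to the odd ones; the lists differ only in which half is
    prefixed by \<open>y\<close>.\<close>
  define \<alpha> \<beta> where ab: "\<alpha> = word_comb c1 (even_words zs)" "\<beta> = word_comb c2 (odd_words zs)"
  define S where "S = word_comb (suslin (Suc k) u' v' *\<^sub>v c2) (even_words zs)"
  define T where "T = word_comb (suslin_bar (Suc k) u' v' *\<^sub>v c1) (odd_words zs)"
  let ?\<Phi> = "clifford \<phi> zs v'"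
  have S: "?\<Phi> \<beta> - S \<in> ext_ideal m" and T: "?\<Phi> \<alpha> - T \<in> ext_ideal m"
    using Suc.IH[OF zm zs uvc \<phi>' cc(1)] Suc.IH[OF zm zs uvc \<phi>' cc(2)]
    by (simp_all add: ab S_def T_def)
  have abm: "\<alpha> \<in> carrier (free_alg m)" "\<beta> \<in> carrier (free_alg m)"
    using word_comb_carrier[OF zm] by (simp_all add: ab)
  have add: "clifford \<phi> ys v (s + t) = clifford \<phi> ys v s + clifford \<phi> ys v t" for s t
    by (simp add: clifford_def free_contract_add distrib_left)
  \<comment> \<open>One computation for both parities: \<open>s\<close> is the part prefixed by
    \<open>y\<close>, and \<open>p\<close>, \<open>q\<close> are the values given by the induction
    hypothesis. The odd words use \<open>\<alpha>\<close>, \<open>\<beta>\<close> for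
    \<open>s\<close>, \<open>t\<close>, the even words \<open>\<beta>\<close>,
    \<open>\<alpha>\<close>.\<close>
  have key: "clifford \<phi> ys v (word [y] * s + t)
      - (scalar (u $ 0) * s + q + word [y] * (- p + scalar (v $ 0) * t)) \<in> ext_ideal m"
    if st: "s \<in> carrier (free_alg m)" "t \<in> carrier (free_alg m)"
      and pq: "?\<Phi> s - p \<in> ext_ideal m" "?\<Phi> t - q \<in> ext_ideal m" for s t p q
  proof -
    \<comment> \<open>The summands lie in the ideal by the square of \<open>y\<close>, by
      anticommutation with \<open>y\<close>, and by the two given congruences; together they make up
      the required difference.\<close>
    have "scalar (v $ 0) * (word [y] * word [y] * s)
        + (?\<Phi> (word [y] * s) - (scalar (u $ 0) * s - word [y] * ?\<Phi> s))
        - word [y] * (?\<Phi> s - p) + (?\<Phi> t - q) \<in> ext_ideal m"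
      by (intro ext_ideal_add ext_ideal_diff ext_ideal_mult_left ext_ideal_mult_right
          ext_ideal_square clifford_word_mult[OF y zm, where \<phi> = \<phi>, unfolded \<phi>] y st pq) (use y in auto)
    also have "scalar (v $ 0) * (word [y] * word [y] * s)
        + (?\<Phi> (word [y] * s) - (scalar (u $ 0) * s - word [y] * ?\<Phi> s))
        - word [y] * (?\<Phi> s - p) + (?\<Phi> t - q) =
      clifford \<phi> ys v (word [y] * s + t)
        - (scalar (u $ 0) * s + q + word [y] * (- p + scalar (v $ 0) * t))"
      unfolding add
      by (simp add: ys clifford_Cons[OF v] zs flip: uv'(2))
        (simp add: algebra_simps scalar_left_commute)
    finally show ?thesis .
  qed
  have dims: "dim_vec c1 = 2 ^ k" "dim_vec c2 = 2 ^ k" using cc by simp_all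
  have "word_comb (suslin (Suc (Suc k)) u v *\<^sub>v c) (even_words ys) =
      scalar (u $ 0) * \<alpha> + S + word [y] * (- T + scalar (v $ 0) * \<beta>)"
    unfolding c suslin_mult_vec(1)[OF cc]
    using zs dims by (simp add: ys word_comb_append word_comb_add word_comb_smult word_comb_uminus
        word_comb_map_Cons ab S_def T_def uv' suslin_bar_transpose del: suslin.simps suslin_bar.simps)
  moreover have "word_comb (suslin_bar (Suc (Suc k)) u v *\<^sub>v c) (odd_words ys) =
      scalar (u $ 0) * \<beta> + T + word [y] * (- S + scalar (v $ 0) * \<alpha>)"
    unfolding c suslin_mult_vec(2)[OF cc]
    using zs dims by (simp add: ys word_comb_append word_comb_add word_comb_smult word_comb_uminus
        word_comb_map_Cons ab S_def T_def uv' suslin_bar_transpose add_ac del: suslin.simps suslin_bar.simps)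
  moreover have "word_comb c (odd_words ys) = word [y] * \<alpha> + \<beta>"
      "word_comb c (even_words ys) = word [y] * \<beta> + \<alpha>"
    using zs dims by (simp_all add: c ys word_comb_append word_comb_map_Cons ab add.commute)
  ultimately show ?case
    using key[OF abm T S] key[OF abm(2,1) S T] by simp
qed

section \<open>Spanning by the monomials\<close>

lemma word_comb_spans:
  fixes ys :: "'a::{comm_ring,comm_monoid_mult} vec list"
  assumes ys: "set ys \<subseteq> carrier_vec m" "length ys = Suc k"
    and gen: "\<And>y. y \<in> carrier_vec m \<Longrightarrow>
      \<exists>v\<in>carrier_vec (Suc k). word [y] - vec_comb ys v \<in> ext_ideal m"
    and w: "set w \<subseteq> carrier_vec m"
  shows "\<exists>c\<in>carrier_vec (2 ^ k).
    word w - word_comb c (if even (length w) then even_words ys else odd_words ys) \<in> ext_ideal m"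
  using w
proof (induction w)
  case Nil
  \<comment> \<open>The empty word is the first entry of \<open>even_words\<close> for every list,
    so the coefficients are 1 followed by zeros.\<close>
  have "\<exists>c\<in>carrier_vec (length (even_words ys)). word [] = (word_comb c (even_words ys) :: 'a tens)" for ys :: "'a vec list"
  proof (induction ys)
    case Nil
    show ?case by (rule bexI[of _ "vec 1 (\<lambda>_. 1)"]) (simp_all add: word_comb_def)
  next
    case (Cons y ys)
    then obtain c where c: "c \<in> carrier_vec (length (even_words ys))" "word [] = (word_comb c (even_words ys) :: 'a tens)"
      by blast
    show ?case
      by (rule bexI[of _ "c @\<^sub>v 0\<^sub>v (length (map ((#) y) (odd_words ys)))"])
        (use c in \<open>simp_all add: word_comb_append del: length_map\<close>)
  qed
  then obtain c where "c \<in> carrier_vec (2 ^ k)" "word [] = (word_comb c (even_words ys) :: 'a tens)"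
    using length_words(1)[OF ys(2)] by metis
  then show ?case by (auto intro!: bexI[of _ c])
next
  case (Cons y w)
  let ?ws = "\<lambda>p. if p then even_words ys else odd_words ys"
  let ?p = "even (length w)"
  obtain c where c: "c \<in> carrier_vec (2 ^ k)" "word w - word_comb c (?ws ?p) \<in> ext_ideal m"
    using Cons by auto
  obtain v where v: "v \<in> carrier_vec (Suc k)" "word [y] - vec_comb ys v \<in> ext_ideal m"
    using gen Cons.prems by auto
  \<comment> \<open>Prepending a letter is, modulo the ideal, the Clifford operator of the zero
    form. Hence the first argument is the zero vector, and the new coefficients are a Suslin matrix
    applied to the old ones.\<close>
  let ?A = "if ?p then suslin_bar (Suc k) (0\<^sub>v (Suc k)) v else suslin (Suc k) (0\<^sub>v (Suc k)) v"
  have "vec_comb ys v * word_comb c (?ws ?p) - word_comb (?A *\<^sub>v c) (?ws (\<not> ?p)) \<in> ext_ideal m"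
    using clifford_suslin[OF ys zero_carrier_vec v(1), of "\<lambda>_. 0" c] c(1)
    by (simp add: clifford_def)
  moreover have "word_comb c (?ws ?p) \<in> carrier (free_alg m)"
    using word_comb_carrier[OF ys(1)] by simp
  \<comment> \<open>Replaces first the word \<open>w\<close> by its combination of monomials, then
    the letter \<open>y\<close> by its expansion in the frame.\<close>
  then have "word [y] * (word w - word_comb c (?ws ?p)) + (word [y] - vec_comb ys v) * word_comb c (?ws ?p)
      \<in> ext_ideal m"
    using Cons.prems by (intro ext_ideal_add ext_ideal_mult_left ext_ideal_mult_right c v) auto
  ultimately have "word [y] * word w - word_comb (?A *\<^sub>v c) (?ws (\<not> ?p)) \<in> ext_ideal m"
    by (drule_tac ext_ideal_add) (auto simp: algebra_simps)
  moreover have "?A *\<^sub>v c \<in> carrier_vec (2 ^ k)"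
    using c(1) by (auto intro!: mult_mat_vec_carrier)
  moreover have "word [y] * word w = (word (y # w) :: 'a tens)"
    by (simp add: single_mult_single)
  ultimately show ?case by (auto intro!: bexI[of _ "?A *\<^sub>v c"])
qed

lemma word_comb_spans_parity:
  fixes ys :: "'a::{comm_ring,comm_monoid_mult} vec list"
  assumes ys: "set ys \<subseteq> carrier_vec m" "length ys = Suc k"
    and gen: "\<And>y. y \<in> carrier_vec m \<Longrightarrow>
      \<exists>v\<in>carrier_vec (Suc k). word [y] - vec_comb ys v \<in> ext_ideal m"
    and t: "t \<in> carrier (free_alg m)" "\<And>w. w \<in> Poly_Mapping.keys t \<Longrightarrow> even (length w) = p"
  defines "ws \<equiv> if p then even_words ys else odd_words ys"
  shows "\<exists>c\<in>carrier_vec (2 ^ k). t - word_comb c ws \<in> ext_ideal m"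
proof -
  have len: "length ws = 2 ^ k" using ys(2) by (simp add: ws_def)
  show ?thesis
  proof (rule single_add_induct[of t])
    fix w and r :: 'a assume "w \<in> Poly_Mapping.keys t"
    then have w: "set w \<subseteq> carrier_vec m" "even (length w) = p"
      using t by (auto simp: free_alg_carrier_iff)
    obtain c where c: "c \<in> carrier_vec (2 ^ k)" "word w - word_comb c ws \<in> ext_ideal m"
      using word_comb_spans[OF ys gen w(1)] unfolding w(2) ws_def[symmetric] by blast
    have "scalar r * (word w - word_comb c ws) \<in> ext_ideal m"
      by (intro ext_ideal_mult_left c) simp
    moreover have "word_comb (r \<cdot>\<^sub>v c) ws = scalar r * word_comb c ws"
      using c(1) len by (intro word_comb_smult) simp
    ultimately show "\<exists>c\<in>carrier_vec (2 ^ k). Poly_Mapping.single w r - word_comb c ws \<in> ext_ideal m"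
      using c(1) by (intro bexI[of _ "r \<cdot>\<^sub>v c"]) (simp_all add: right_diff_distrib single_mult_single)
  next
    have "word_comb (0\<^sub>v (2 ^ k)) ws = (0 :: 'a tens)"
      using word_comb_0[of ws] unfolding len .
    then show "\<exists>c\<in>carrier_vec (2 ^ k). 0 - word_comb c ws \<in> ext_ideal m"
      by (intro bexI[of _ "0\<^sub>v (2 ^ k)"]) simp_all
  next
    fix s t assume "\<exists>c\<in>carrier_vec (2 ^ k). s - word_comb c ws \<in> ext_ideal m"
      "\<exists>c\<in>carrier_vec (2 ^ k). t - word_comb c ws \<in> ext_ideal m"
    then obtain c d where cd: "c \<in> carrier_vec (2 ^ k)" "d \<in> carrier_vec (2 ^ k)"
      "s - word_comb c ws \<in> ext_ideal m" "t - word_comb d ws \<in> ext_ideal m" by blast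
    have "word_comb (c + d) ws = word_comb c ws + word_comb d ws"
      using cd len by (intro word_comb_add) simp
    then show "\<exists>c\<in>carrier_vec (2 ^ k). s + t - word_comb c ws \<in> ext_ideal m"
      using cd ext_ideal_add[OF cd(3,4)] by (intro bexI[of _ "c + d"]) (simp_all add: add_diff_add)
  qed
qed

section \<open>Independence of the monomials\<close>

text \<open>\<^const>\<open>unit_vec\<close> would exclude the zero ring.\<close>

definition std_vec :: "nat \<Rightarrow> nat \<Rightarrow> 'a::{comm_ring,comm_monoid_mult} vec" where
  "std_vec m j = vec m (\<lambda>i. if i = j then 1 else 0)"

lemma std_vec_carrier [simp]: "std_vec m j \<in> carrier_vec m"
  by (simp add: std_vec_def)

lemma dim_std_vec [simp]: "dim_vec (std_vec m j) = m"
  by (simp add: std_vec_def)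

lemma std_vec_index [simp]: "i < m \<Longrightarrow> std_vec m j $ i = (if i = j then 1 else 0)"
  by (simp add: std_vec_def)

text \<open>The form \<open>\<phi>\<close> kills every letter of \<open>ws\<close> and
  \<open>vs\<close>, so contraction maps the given element to the second combination and stays in
  the ideal. Subtracting \<open>word [e]\<close> times that combination leaves the first
  one.\<close>

lemma word_comb_split:
  fixes e :: "'a::{comm_ring,comm_monoid_mult} vec"
  assumes add: "\<And>x y. x \<in> carrier_vec m \<Longrightarrow> y \<in> carrier_vec m \<Longrightarrow> \<phi> (x + y) = \<phi> x + \<phi> y"
    and smult: "\<And>r x. x \<in> carrier_vec m \<Longrightarrow> \<phi> (r \<cdot>\<^sub>v x) = r * \<phi> x"
    and \<phi>: "\<phi> e = 1" "\<And>w y. w \<in> set ws \<union> set vs \<Longrightarrow> y \<in> set w \<Longrightarrow> \<phi> y = 0"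
    and e: "e \<in> carrier_vec m"
    and st: "word_comb s ws + word [e] * word_comb t vs \<in> ext_ideal m"
  shows "word_comb s ws \<in> ext_ideal m \<and> word_comb t vs \<in> ext_ideal m"
proof -
  have "free_contract \<phi> (word_comb s ws) = 0" "free_contract \<phi> (word_comb t vs) = 0"
    by (rule free_contract_eq_0; use \<phi>(2) keys_word_comb in blast)+
  with free_contract_ext_ideal[OF add smult st] have t: "word_comb t vs \<in> ext_ideal m"
    by (simp add: free_contract_add free_contract_word_mult \<phi>(1))
  then have "word [e] * word_comb t vs \<in> ext_ideal m"
    using e by (intro ext_ideal_mult_left) auto
  from ext_ideal_diff[OF st this] t show ?thesis by simp
qed

text \<open>Basis vectors are split off one at a time inside the fixed algebra of
  \<open>R^m\<close>, until only the empty word is left, whose coefficient is read off by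
  \<open>lookup_Nil_ext_ideal\<close>.\<close>

lemma word_comb_eq_0:
  assumes "distinct js" "set js \<subseteq> {..<m}"
  defines "ys \<equiv> map (std_vec m) js :: 'a::{comm_ring,comm_monoid_mult} vec list"
  shows "(\<forall>c\<in>carrier_vec (length (even_words ys)).
      word_comb c (even_words ys) \<in> ext_ideal m \<longrightarrow> c = 0\<^sub>v (length (even_words ys))) \<and>
    (\<forall>c\<in>carrier_vec (length (odd_words ys)).
      word_comb c (odd_words ys) \<in> ext_ideal m \<longrightarrow> c = 0\<^sub>v (length (odd_words ys)))"
  using assms(1,2) unfolding ys_def
proof (induction js)
  case Nil
  have "c = 0\<^sub>v 1" if c: "c \<in> carrier_vec 1" "word_comb c [[]] \<in> ext_ideal m" for c :: "'a vec"
  proof -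
    have "Poly_Mapping.lookup (word_comb c [[]] :: 'a tens) [] = c $ 0"
      by (simp add: word_comb_def)
    then show ?thesis using lookup_Nil_ext_ideal[OF c(2)] c(1) by (intro eq_vecI) auto
  qed
  moreover have "c = 0\<^sub>v 0" if "c \<in> carrier_vec 0" for c :: "'a vec"
    using that by (intro eq_vecI) auto
  ultimately show ?case by auto
next
  case (Cons j js)
  let ?e = "std_vec m j :: 'a vec" and ?ys = "map (std_vec m) js :: 'a vec list"
  let ?E = "even_words ?ys" and ?O = "odd_words ?ys"
  \<comment> \<open>The form dual to the vector split off; distinctness makes it vanish on the
    remaining ones.\<close>
  let ?\<phi> = "\<lambda>x :: 'a vec. x $ j"
  have j: "j < m" "j \<notin> set js" using Cons.prems by auto
  have IH: "c \<in> carrier_vec (length ?E) \<Longrightarrow> word_comb c ?E \<in> ext_ideal m \<Longrightarrow> c = 0\<^sub>v (length ?E)"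
    "c \<in> carrier_vec (length ?O) \<Longrightarrow> word_comb c ?O \<in> ext_ideal m \<Longrightarrow> c = 0\<^sub>v (length ?O)" for c
    using Cons by simp_all
  have zero: "?\<phi> y = 0" if "w \<in> set ?E \<union> set ?O" "y \<in> set w" for w y
  proof -
    have "y \<in> set ?ys" using that set_words[of w ?ys] by auto
    then show ?thesis using j by auto
  qed
  have split: "word_comb s ws \<in> ext_ideal m \<and> word_comb t vs \<in> ext_ideal m"
    if "word_comb s ws + word [?e] * word_comb t vs \<in> ext_ideal m"
      "set ws \<union> set vs \<subseteq> set ?E \<union> set ?O" for s t ws vs
    by (rule word_comb_split[where \<phi> = ?\<phi>, OF _ _ _ _ _ that(1)])
      (use j zero that(2) in \<open>auto simp del: set_map\<close>)
  have "c = 0\<^sub>v (length (even_words (?e # ?ys)))"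
    if c: "c \<in> carrier_vec (length (even_words (?e # ?ys)))"
      "word_comb c (even_words (?e # ?ys)) \<in> ext_ideal m" for c
  proof -
    define s t where "s = vec_first c (length ?E)" "t = vec_last c (length ?O)"
    then have st: "c = s @\<^sub>v t" "s \<in> carrier_vec (length ?E)" "t \<in> carrier_vec (length ?O)"
      using c(1) by simp_all
    have "word_comb s ?E \<in> ext_ideal m \<and> word_comb t ?O \<in> ext_ideal m"
      by (rule split) (use c(2) st in \<open>auto simp: word_comb_append word_comb_map_Cons\<close>)
    then have "s = 0\<^sub>v (length ?E)" "t = 0\<^sub>v (length ?O)" using IH st by auto
    then show ?thesis by (auto simp: st(1) intro!: eq_vecI)
  qed
  moreover have "c = 0\<^sub>v (length (odd_words (?e # ?ys)))"
    if c: "c \<in> carrier_vec (length (odd_words (?e # ?ys)))"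
      "word_comb c (odd_words (?e # ?ys)) \<in> ext_ideal m" for c
  proof -
    define s t where "s = vec_first c (length ?E)" "t = vec_last c (length ?O)"
    then have st: "c = s @\<^sub>v t" "s \<in> carrier_vec (length ?E)" "t \<in> carrier_vec (length ?O)"
      using c(1) by simp_all
    \<comment> \<open>In \<open>odd_words\<close> the block prefixed by the new vector comes first,
      so the halves enter \<open>split\<close> in the opposite order.\<close>
    have "word_comb t ?O \<in> ext_ideal m \<and> word_comb s ?E \<in> ext_ideal m"
      by (rule split) (use c(2) st in \<open>auto simp: word_comb_append word_comb_map_Cons add.commute\<close>)
    then have "s = 0\<^sub>v (length ?E)" "t = 0\<^sub>v (length ?O)" using IH st by auto
    then show ?thesis by (auto simp: st(1) intro!: eq_vecI)
  qed
  ultimately show ?case by simp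
qed

section \<open>Passage to the exterior algebra\<close>

text \<open>Replaces a sum of homogeneous classes by one representative whose words all have the
  right parity. The remainder \<open>r\<close> treats even and odd together.\<close>

lemma ext_parity_eq:
  assumes r: "r < 2"
  shows "{\<Oplus>\<^bsub>ext_alg m\<^esub>i\<in>{..N}. c i | (N :: nat) c. \<forall>i. c i \<in> ext_power m (2 * i + r)} =
    (ext_class m :: 'a::{comm_ring,comm_monoid_mult} tens \<Rightarrow> 'a ext) `
      {t \<in> carrier (free_alg m). \<forall>w\<in>Poly_Mapping.keys t. length w mod 2 = r}"
    (is "?L = ?R")
proof (intro equalityI subsetI)
  fix \<omega> :: "'a ext" assume "\<omega> \<in> ?L"
  then obtain N c where \<omega>: "\<omega> = (\<Oplus>\<^bsub>ext_alg m\<^esub>i\<in>{..N}. c i)"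
    and c: "\<And>i. c i \<in> ext_power m (2 * i + r)" by blast
  from c have "\<forall>i. \<exists>t. c i = ext_class m t \<and> t \<in> carrier (free_alg m) \<and>
      (\<forall>w\<in>Poly_Mapping.keys t. length w = 2 * i + r)"
    unfolding ext_power_def by blast
  then obtain t where t: "\<And>i. c i = ext_class m (t i)" "\<And>i. t i \<in> carrier (free_alg m)"
      "\<And>i w. w \<in> Poly_Mapping.keys (t i) \<Longrightarrow> length w = 2 * i + r"
    by metis
  have "\<omega> = ext_class m (sum t {..N})"
    unfolding \<omega> t(1) by (rule ext_class_sum) (use t(2) in auto)
  moreover have "length w mod 2 = r" if "w \<in> Poly_Mapping.keys (sum t {..N})" for w
  proof -
    from that keys_sum_subset[of t "{..N}"] obtain i where "w \<in> Poly_Mapping.keys (t i)" by blast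
    with t(3) r show ?thesis by simp
  qed
  ultimately show "\<omega> \<in> ?R" using t(2) by auto
next
  fix \<omega> :: "'a ext" assume "\<omega> \<in> ?R"
  then obtain t where \<omega>: "\<omega> = ext_class m t" and t: "t \<in> carrier (free_alg m)"
      "\<And>w. w \<in> Poly_Mapping.keys t \<Longrightarrow> length w mod 2 = r" by auto
  let ?K = "\<lambda>i. {w \<in> Poly_Mapping.keys t. length w div 2 = i}"
  \<comment> \<open>Words of parity \<open>r\<close> with half-length \<open>i\<close> have length
    \<open>2 * i + r\<close>, so \<open>s i\<close> is the homogeneous part of that degree.\<close>
  define s where "s = (\<lambda>i. \<Sum>w\<in>?K i. Poly_Mapping.single w (Poly_Mapping.lookup t w))"
  obtain N where N: "\<And>w. w \<in> Poly_Mapping.keys t \<Longrightarrow> length w div 2 \<le> N"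
    using finite_nat_set_iff_bounded_le[of "(\<lambda>w. length w div 2) ` Poly_Mapping.keys t"] by auto
  have sc: "s i \<in> carrier (free_alg m)" for i
    unfolding s_def using t(1) by (intro free_alg_sum free_alg_single) (auto simp: free_alg_carrier_iff)
  have "sum s {..N} = (\<Sum>w\<in>Poly_Mapping.keys t. Poly_Mapping.single w (Poly_Mapping.lookup t w))"
    unfolding s_def by (rule sum.group) (use N in auto)
  then have "sum s {..N} = t" by (simp add: sum_singles)
  moreover have "(\<Oplus>\<^bsub>ext_alg m\<^esub>i\<in>{..N}. ext_class m (s i)) = ext_class m (sum s {..N})"
    by (rule ext_class_sum) (use sc in auto)
  moreover have "ext_class m (s i) \<in> ext_power m (2 * i + r)" for i
  proof -
    have "length w = 2 * i + r" if "w \<in> Poly_Mapping.keys (s i)" for w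
    proof -
      from that keys_sum_subset[of "\<lambda>w. Poly_Mapping.single w (Poly_Mapping.lookup t w)" "?K i"]
      have "w \<in> Poly_Mapping.keys t" "length w div 2 = i" by (auto simp: s_def split: if_splits)
      with t(2)[of w] show ?thesis by auto
    qed
    then show ?thesis unfolding ext_power_def using sc by blast
  qed
  ultimately show "\<omega> \<in> ?L" unfolding \<omega> by (intro CollectI exI[of _ N] exI[of _ "\<lambda>i. ext_class m (s i)"]) simp
qed

lemma ext_even_eq:
  "ext_even m = ext_class m ` {t \<in> carrier (free_alg m). \<forall>w\<in>Poly_Mapping.keys t. even (length w)}"
  using ext_parity_eq[of 0 m] unfolding ext_even_def by (simp add: even_iff_mod_2_eq_zero)

lemma ext_odd_eq:
  "ext_odd m = ext_class m ` {t \<in> carrier (free_alg m). \<forall>w\<in>Poly_Mapping.keys t. odd (length w)}"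
  using ext_parity_eq[of 1 m] unfolding ext_odd_def by (simp add: odd_iff_mod_2_eq_one)

lemma ext_lincomb_words:
  assumes "\<And>w. w \<in> set ws \<Longrightarrow> set w \<subseteq> carrier_vec m"
  shows "ext_lincomb m c (map (\<lambda>w. ext_class m (word w)) ws) = ext_class m (word_comb c ws)"
proof -
  have "ext_scale m (c $ i) (ext_class m (word (ws ! i))) = ext_class m (Poly_Mapping.single (ws ! i) (c $ i))"
    if "i < length ws" for i
    using that assms by (simp add: ext_scale_def ext_class_mult single_mult_single)
  then have "ext_lincomb m c (map (\<lambda>w. ext_class m (word w)) ws) =
      (\<Oplus>\<^bsub>ext_alg m\<^esub>i\<in>{..<length ws}. ext_class m (Poly_Mapping.single (ws ! i) (c $ i)))"
    unfolding ext_lincomb_def using assms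
    by (intro abelian_monoid.finsum_cong')
      (auto intro!: ext_class_carrier abelian_group.axioms ring.is_abelian_group
        ring_hom_ring.axioms(2)[OF ext_class_hom])
  also have "\<dots> = ext_class m (word_comb c ws)"
    unfolding word_comb_def using assms by (intro ext_class_sum) auto
  finally show ?thesis .
qed

text \<open>Translates spanning and independence modulo the ideal into unique coordinates. Two
  coordinate vectors of one class have a difference whose combination lies in the ideal, hence they
  agree.\<close>

lemma ordered_basis_words:
  fixes M :: "'a::{comm_ring,comm_monoid_mult} ext set"
  assumes ws: "\<And>w. w \<in> set ws \<Longrightarrow> set w \<subseteq> carrier_vec m \<and> (even (length w) \<longleftrightarrow> p)"
    and M: "M = ext_class m ` {t \<in> carrier (free_alg m). \<forall>w\<in>Poly_Mapping.keys t. even (length w) \<longleftrightarrow> p}"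
    and span: "\<And>t. t \<in> carrier (free_alg m) \<Longrightarrow> \<forall>w\<in>Poly_Mapping.keys t. even (length w) \<longleftrightarrow> p \<Longrightarrow>
      \<exists>c\<in>carrier_vec (length ws). t - word_comb c ws \<in> ext_ideal m"
    and indep: "\<And>c :: 'a vec. c \<in> carrier_vec (length ws) \<Longrightarrow> word_comb c ws \<in> ext_ideal m \<Longrightarrow> c = 0\<^sub>v (length ws)"
  shows "ordered_basis m M (map (\<lambda>w. ext_class m (word w)) ws)"
proof -
  have ws': "set w \<subseteq> carrier_vec m" if "w \<in> set ws" for w using ws that by simp
  have wc: "word_comb c ws \<in> carrier (free_alg m)" for c :: "'a vec"
    using keys_word_comb[of c ws] ws' unfolding free_alg_carrier_iff by blast
  have "\<exists>!c. c \<in> carrier_vec (length ws) \<and> \<omega> = ext_class m (word_comb c ws)"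
    if "\<omega> \<in> M" for \<omega>
  proof -
    from that obtain t where t: "\<omega> = ext_class m t" "t \<in> carrier (free_alg m)"
      "\<forall>w\<in>Poly_Mapping.keys t. even (length w) \<longleftrightarrow> p" unfolding M by blast
    from span[OF t(2,3)] obtain c where c: "c \<in> carrier_vec (length ws)" "t - word_comb c ws \<in> ext_ideal m"
      by blast
    show ?thesis
    proof (rule ex1I[of _ c])
      show "c \<in> carrier_vec (length ws) \<and> \<omega> = ext_class m (word_comb c ws)"
        using c t wc by (simp add: ext_class_eq_iff)
      fix d assume d: "d \<in> carrier_vec (length ws) \<and> \<omega> = ext_class m (word_comb d ws)"
      then have "t - word_comb d ws \<in> ext_ideal m"
        using t wc by (simp add: ext_class_eq_iff)
      from ext_ideal_diff[OF c(2) this] have "word_comb d ws - word_comb c ws \<in> ext_ideal m" by simp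
      then have "word_comb (d - c) ws \<in> ext_ideal m" using c by (simp add: word_comb_diff)
      then have "d - c = 0\<^sub>v (length ws)" using c d by (intro indep) auto
      then show "d = c"
        using c(1) d by (intro eq_vecI) (auto dest: arg_cong[where f = "\<lambda>x. x $ _"] simp: vec_eq_iff)
    qed
  qed
  moreover have "ext_class m (word w) \<in> M" if "w \<in> set ws" for w
    unfolding M using ws[OF that] by auto
  ultimately show ?thesis
    unfolding ordered_basis_def by (auto simp: ext_lincomb_words[OF ws'])
qed

section \<open>Contraction on cosets and expansion of vectors\<close>

lemma ext_class_elements: "ext_class m t = (\<lambda>h. h + t) ` ext_ideal m"
  by (auto simp: ext_class_def a_r_coset_def r_coset_def free_alg_def)

text \<open>The union in \<open>contract\<close> runs over all \<open>h + t\<close> with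
  \<open>h\<close> in the ideal. Contraction preserves the ideal, so each of them contributes the
  same coset, and the index set is nonempty.\<close>

lemma contract_class:
  fixes \<phi> :: "'a::{comm_ring,comm_monoid_mult} vec \<Rightarrow> 'a"
  assumes "\<And>x y. x \<in> carrier_vec m \<Longrightarrow> y \<in> carrier_vec m \<Longrightarrow> \<phi> (x + y) = \<phi> x + \<phi> y"
    and "\<And>r x. x \<in> carrier_vec m \<Longrightarrow> \<phi> (r \<cdot>\<^sub>v x) = r * \<phi> x"
    and t: "t \<in> carrier (free_alg m)"
  shows "contract m \<phi> (ext_class m t) = ext_class m (free_contract \<phi> t)"
proof -
  have "ext_class m (free_contract \<phi> (h + t)) = ext_class m (free_contract \<phi> t)"
    if h: "h \<in> ext_ideal m" for h
    using free_contract_ext_ideal[OF assms(1,2) h] ext_ideal_carrier[OF h] t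
    by (subst ext_class_eq_iff) (simp_all add: free_contract_add)
  moreover have "ext_ideal m \<noteq> ({} :: 'a tens set)" using ext_ideal_zero by blast
  ultimately show ?thesis by (simp add: contract_def ext_class_elements[of m t])
qed

lemma word_zero_vec:
  "(word [0\<^sub>v m] :: 'a::{comm_ring,comm_monoid_mult} tens) \<in> ext_ideal m"
proof -
  have "(word [0 \<cdot>\<^sub>v 0\<^sub>v m] - Poly_Mapping.single [0\<^sub>v m] 0 :: 'a tens) \<in> ext_ideal m"
    by (rule ext_ideal_word_smult) simp
  moreover have "0 \<cdot>\<^sub>v 0\<^sub>v m = (0\<^sub>v m :: 'a vec)" by (intro eq_vecI) auto
  ultimately show ?thesis by simp
qed

lemma word_std_expansion:
  fixes y :: "'a::{comm_ring,comm_monoid_mult} vec"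
  assumes "y \<in> carrier_vec m"
  shows "word [y] - (\<Sum>i<m. Poly_Mapping.single [std_vec m i] (y $ i)) \<in> ext_ideal m"
proof -
  \<comment> \<open>Truncations of \<open>y\<close> to the first \<open>k\<close> coordinates: each
    step adds one coordinate and costs one additivity and one scaling relation. The start is the
    letter \<open>0\<^sub>v m\<close>, which lies in the ideal without being 0 in the free
    algebra.\<close>
  let ?y = "\<lambda>k. vec m (\<lambda>i. if i < k then y $ i else 0)"
  have "word [?y k] - (\<Sum>i<k. Poly_Mapping.single [std_vec m i] (y $ i)) \<in> ext_ideal m" if "k \<le> m" for k
    using that
  proof (induction k)
    case 0
    have "?y 0 = 0\<^sub>v m" by (intro eq_vecI) auto
    then show ?case using word_zero_vec by simp
  next
    case (Suc k)
    let ?z = "y $ k \<cdot>\<^sub>v std_vec m k"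
    have y: "?y (Suc k) = ?y k + ?z" using Suc.prems by (intro eq_vecI) (auto simp: less_Suc_eq)
    have "word [?y (Suc k)] - word [?y k] - word [?z] \<in> ext_ideal m"
      unfolding y by (rule ext_ideal_word_add) auto
    moreover have "word [?z] - Poly_Mapping.single [std_vec m k] (y $ k) \<in> ext_ideal m"
      by (rule ext_ideal_word_smult) simp
    moreover have "word [?y k] - (\<Sum>i<k. Poly_Mapping.single [std_vec m i] (y $ i)) \<in> ext_ideal m"
      using Suc by simp
    ultimately have "(word [?y (Suc k)] - word [?y k] - word [?z])
        + (word [?z] - Poly_Mapping.single [std_vec m k] (y $ k))
        + (word [?y k] - (\<Sum>i<k. Poly_Mapping.single [std_vec m i] (y $ i))) \<in> ext_ideal m"
      by (intro ext_ideal_add)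
    then show ?case by (simp add: algebra_simps)
  qed
  moreover have "?y m = y" using assms by (intro eq_vecI) auto
  ultimately show ?thesis by force
qed

text \<open>The last basis vector comes first, because the last coordinates \<open>a\<close> and \<open>b\<close> of \<open>x'\<close> and \<open>x''\<close>
  are the first entries of the arguments of the Suslin matrix.\<close>

definition suslin_frame :: "nat \<Rightarrow> 'a::{comm_ring,comm_monoid_mult} vec list" where
  "suslin_frame n = map (std_vec (Suc n)) (n # [0..<n])"

lemma length_suslin_frame [simp]: "length (suslin_frame n) = Suc n"
  by (simp add: suslin_frame_def)

lemma suslin_frame_nth:
  "suslin_frame n ! 0 = std_vec (Suc n) n"
  "j < n \<Longrightarrow> suslin_frame n ! Suc j = std_vec (Suc n) j"
  by (simp_all add: suslin_frame_def)

lemma suslin_frame_carrier [simp]: "set (suslin_frame n) \<subseteq> carrier_vec (Suc n)"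
  by (auto simp: suslin_frame_def)

lemma vec_comb_suslin_frame:
  fixes y :: "'a::{comm_ring,comm_monoid_mult} vec"
  assumes "y \<in> carrier_vec (Suc n)"
  shows "word [y] - vec_comb (suslin_frame n) (vCons (y $ n) (vec n (\<lambda>i. y $ i))) \<in> ext_ideal (Suc n)"
proof -
  have "vec_comb (suslin_frame n) (vCons (y $ n) (vec n (\<lambda>i. y $ i))) =
      (\<Sum>i<Suc n. Poly_Mapping.single [std_vec (Suc n) i] (y $ i) :: 'a tens)"
    unfolding vec_comb_def length_suslin_frame
    by (subst sum.lessThan_Suc_shift) (simp add: suslin_frame_nth add.commute)
  then show ?thesis using word_std_expansion[OF assms] by simp
qed

section \<open>The map \<open>Phi\<close> in coordinates\<close>

lemma scalar_prod_std_vec: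
  assumes "(g :: 'a::{comm_ring,comm_monoid_mult} vec) \<in> carrier_vec m" "j < m"
  shows "g \<bullet> std_vec m j = g $ j"
proof -
  have "g \<bullet> std_vec m j = (\<Sum>i\<in>{0..<m}. if i = j then g $ i else 0)"
    unfolding scalar_prod_def by (rule sum.cong) auto
  then show ?thesis using assms by simp
qed

lemma Phi_class:
  assumes p: "p \<in> carrier_vec n" and f: "f \<in> carrier_vec n" and t: "t \<in> carrier (free_alg (Suc n))"
  shows "Phi n (p, a, f, b) (ext_class (Suc n) t) =
    ext_class (Suc n) (clifford (scalar_prod (f @\<^sub>v vec_of_list [b])) (suslin_frame n) (vCons a p) t)"
proof -
  let ?y = "p @\<^sub>v vec_of_list [a]" and ?\<phi> = "scalar_prod (f @\<^sub>v vec_of_list [b])"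
  have y: "?y \<in> carrier_vec (Suc n)" and g: "f @\<^sub>v vec_of_list [b] \<in> carrier_vec (Suc n)"
    by (rule carrier_vecI; use p f in simp)+
  have "contract (Suc n) ?\<phi> (ext_class (Suc n) t) = ext_class (Suc n) (free_contract ?\<phi> t)"
    by (rule contract_class[OF scalar_prod_add_distrib[OF g] scalar_prod_smult_distrib[OF g] t])
  then have "Phi n (p, a, f, b) (ext_class (Suc n) t) =
      ext_class (Suc n) (word [?y] * t + free_contract ?\<phi> t)"
    using t y by (simp add: Phi_def left_wedge_def ext_class_mult ext_class_add del: vec_of_list_Cons)
  also have "\<dots> = ext_class (Suc n) (clifford ?\<phi> (suslin_frame n) (vCons a p) t)"
  proof -
    \<comment> \<open>The vector \<open>(p, a)\<close> has coordinates \<open>vCons a p\<close> in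
      the frame, where the last basis vector comes first.\<close>
    have "vec n (\<lambda>i. ?y $ i) = p" "?y $ n = a"
      using p by (auto intro!: eq_vecI)
    with vec_comb_suslin_frame[OF y]
    have "word [?y] - vec_comb (suslin_frame n) (vCons a p) \<in> ext_ideal (Suc n)"
      by simp
    then have "(word [?y] - vec_comb (suslin_frame n) (vCons a p)) * t \<in> ext_ideal (Suc n)"
      using t by (intro ext_ideal_mult_right)
    then show ?thesis
      using t y
      by (subst ext_class_eq_iff) (simp_all add: clifford_def left_diff_distrib)
  qed
  finally show ?thesis .
qed

theorem theorem3p5:
  fixes n :: nat
  shows "\<exists>B1 B0 :: 'a::{comm_ring,comm_monoid_mult} ext list.
    ordered_basis (Suc n) (ext_odd (Suc n)) B1 \<and>
    ordered_basis (Suc n) (ext_even (Suc n)) B0 \<and>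
    (\<forall>p\<in>carrier_vec n. \<forall>a. \<forall>f\<in>carrier_vec n. \<forall>b.
      represents (Suc n) B1 B0 (suslin (Suc n) (vCons b f) (vCons a p)) (Phi_10 n (p, a, f, b)) \<and>
      represents (Suc n) B0 B1 (suslin_bar (Suc n) (vCons b f) (vCons a p)) (Phi_01 n (p, a, f, b)))"
proof -
  let ?m = "Suc n" and ?cls = "\<lambda>w. ext_class (Suc n) (word w) :: 'a ext"
  define ys :: "'a vec list" where "ys = suslin_frame n"
  define E where "E = even_words ys"
  define O' where "O' = odd_words ys"
  have ys: "set ys \<subseteq> carrier_vec ?m" "length ys = Suc n"
    by (simp_all add: ys_def)
  have len: "length E = 2 ^ n" "length O' = 2 ^ n" using ys by (simp_all add: E_def O'_def)
  have E: "set w \<subseteq> carrier_vec ?m \<and> (even (length w) \<longleftrightarrow> True)" if "w \<in> set E" for w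
    using that set_words(1) ys(1) unfolding E_def by blast
  have O': "set w \<subseteq> carrier_vec ?m \<and> (even (length w) \<longleftrightarrow> False)" if "w \<in> set O'" for w
    using that set_words(2) ys(1) unfolding O'_def by blast
  have gen: "\<exists>v\<in>carrier_vec (Suc n). word [y] - vec_comb ys v \<in> ext_ideal ?m"
    if "y \<in> carrier_vec ?m" for y :: "'a vec"
    using vec_comb_suslin_frame[OF that] unfolding ys_def by (intro bexI) auto
  have indep: "c = 0\<^sub>v (length E)" if "c \<in> carrier_vec (length E)" "word_comb c E \<in> ext_ideal ?m" for c
    using word_comb_eq_0[of "n # [0..<n]" ?m] that
    unfolding E_def ys_def suslin_frame_def by force
  have indep': "c = 0\<^sub>v (length O')" if "c \<in> carrier_vec (length O')" "word_comb c O' \<in> ext_ideal ?m" for c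
    using word_comb_eq_0[of "n # [0..<n]" ?m] that
    unfolding O'_def ys_def suslin_frame_def by force
  have "ordered_basis ?m (ext_even ?m) (map ?cls E)"
    by (rule ordered_basis_words[OF E _ _ indep])
      (use word_comb_spans_parity[OF ys gen, where p = True] in \<open>auto simp: ext_even_eq len E_def[symmetric]\<close>)
  moreover have "ordered_basis ?m (ext_odd ?m) (map ?cls O')"
    by (rule ordered_basis_words[OF O' _ _ indep'])
      (use word_comb_spans_parity[OF ys gen, where p = False] in \<open>auto simp: ext_odd_eq len O'_def[symmetric]\<close>)
  moreover have "represents ?m (map ?cls O') (map ?cls E) (suslin ?m (vCons b f) (vCons a p)) (Phi_10 n (p, a, f, b)) \<and>
      represents ?m (map ?cls E) (map ?cls O') (suslin_bar ?m (vCons b f) (vCons a p)) (Phi_01 n (p, a, f, b))"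
    if p: "p \<in> carrier_vec n" and f: "f \<in> carrier_vec n" for p f a b
  proof -
    let ?u = "vCons b f" and ?v = "vCons a p" and ?\<phi> = "scalar_prod (f @\<^sub>v vec_of_list [b])"
    have wcE: "word_comb c E \<in> carrier (free_alg ?m)" and wcO: "word_comb c O' \<in> carrier (free_alg ?m)" for c
      using word_comb_carrier[OF ys(1)] by (simp_all add: E_def O'_def)
    have lcE: "ext_lincomb ?m c (map ?cls E) = ext_class ?m (word_comb c E)"
      and lcO: "ext_lincomb ?m c (map ?cls O') = ext_class ?m (word_comb c O')" for c
      using E O' by (auto intro!: ext_lincomb_words)
    have clc: "clifford ?\<phi> ys ?v t \<in> carrier (free_alg ?m)" if "t \<in> carrier (free_alg ?m)" for t
      using that ys(1) by (simp add: clifford_def)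
    \<comment> \<open>The form \<open>(f, b)\<close> takes the value \<open>b\<close> on frame
      vector 0 and \<open>f $ i\<close> on frame vector \<open>Suc i\<close>; these are the entries
      of \<open>vCons b f\<close>.\<close>
    have \<phi>: "?\<phi> (ys ! j) = ?u $ j" if "j < Suc n" for j
    proof -
      have g: "f @\<^sub>v vec_of_list [b] \<in> carrier_vec (Suc n)" by (rule carrier_vecI) (use f in simp)
      show ?thesis
        using that f scalar_prod_std_vec[OF g, of n] scalar_prod_std_vec[OF g, of "j - 1"]
        by (cases j) (auto simp: ys_def suslin_frame_nth)
    qed
    have rep: "clifford ?\<phi> ys ?v (word_comb c O') - word_comb (suslin ?m ?u ?v *\<^sub>v c) E \<in> ext_ideal ?m"
      "clifford ?\<phi> ys ?v (word_comb c E) - word_comb (suslin_bar ?m ?u ?v *\<^sub>v c) O' \<in> ext_ideal ?m"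
      if "c \<in> carrier_vec (2 ^ n)" for c
      using clifford_suslin[OF ys _ _ \<phi> that] p f by (simp_all add: E_def O'_def)
    \<comment> \<open>\<open>Phi_10\<close> and \<open>Phi_01\<close> are restrictions, so the
      combinations must be known to lie in the odd and even part before they agree with
      \<open>Phi\<close> there.\<close>
    have "ext_class ?m (word_comb c O') \<in> ext_odd ?m" "ext_class ?m (word_comb c E) \<in> ext_even ?m" for c
      using wcE[of c] wcO[of c] keys_word_comb[of c] E O' unfolding ext_odd_eq ext_even_eq by blast+
    moreover have "Phi n (p, a, f, b) (ext_class ?m (word_comb c O')) = ext_class ?m (word_comb (suslin ?m ?u ?v *\<^sub>v c) E)"
      "Phi n (p, a, f, b) (ext_class ?m (word_comb c E)) = ext_class ?m (word_comb (suslin_bar ?m ?u ?v *\<^sub>v c) O')"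
      if "c \<in> carrier_vec (2 ^ n)" for c
      unfolding Phi_class[OF p f wcO] Phi_class[OF p f wcE] ys_def[symmetric]
      using rep[OF that] wcE wcO clc by (simp_all add: ext_class_eq_iff)
    ultimately show ?thesis
      by (simp add: represents_def Phi_10_def Phi_01_def len lcE lcO)
  qed
  ultimately show ?thesis by blast
qed

end
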